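(* Let $1<p\le q<\infty$, $0\le\alpha<n$, let $m\ge1$ be an integer, $\mathbf b=(b_1,\ldots,b_m)$ with each $b_i\in L^1_{\mathrm{loc}}(\mathbb R^n)$, $\tau\subseteq\{1,\ldots,m\}$, and let $\mathcal S$ be a sparse family of dyadic cubes. Let $A,B$ be Young functions with $\bar A\in B_{q',s'}$ and $\bar B\in B_{p,s}$ for some $s$ with $p\le s\le q$. If $u,v$ are a pair of weights and $$\mathsf K_{\alpha,\tau}=\sup_{Q\in\mathcal S}|Q|^{\frac\alpha n+\frac1q-\frac1p}\Big\|\prod_{i\in\tau}(b_i-(b_i)_Q)u^{\frac1q}\Big\|_{A,Q}\Big\|\prod_{l\in\tau^c}(b_l-(b_l)_Q)v^{-\frac1p}\Big\|_{B,Q},$$ then $\|T^{\alpha,\tau}_{\mathcal S,\mathbf b}f\|_{L^q(u)}\lesssim\mathsf K_{\alpha,\tau}\|f\|_{L^p(v)}$.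
   Context: A weight is a nonnegative locally integrable function; for a pair $(u,v)$, $u$ is positive on a set of positive measure and $v$ is positive a.e. A Young function $A$ is increasing, convex, $A(0)=0$, $A(t)/t\to\infty$; $\bar A$ is its associate Young function ($A^{-1}(t)\bar A^{-1}(t)\approx t$). $\|f\|_{A,Q}=\inf\{\lambda>0:\frac1{|Q|}\int_QA(|f|/\lambda)\le1\}$. For $1<p\le q<\infty$, $A\in B_{p,q}$ means $\int_1^\infty\frac{A(t)^{q/p}}{t^q}\frac{dt}{t}<\infty$; $r'=r/(r-1)$. A family $\mathcal S$ of cubes is sparse if there is $0<\eta<1$ and pairwise disjoint measurable $E_Q\subseteq Q$, $Q\in\mathcal S$, with $|E_Q|\ge\eta|Q|$. With $\tau^c=\{1,\ldots,m\}\setminus\tau$, $(b)_Q=\frac1{|Q|}\int_Qb$ and empty products equal to $1$, $$T^{\alpha,\tau}_{\mathcal S,\mathbf b}f(x)=\sum_{Q\in\mathcal S}|Q|^{\frac\alpha n}\Big(\prod_{i\in\tau}|b_i(x)-(b_i)_Q|\,\frac1{|Q|}\int_Q\prod_{l\in\tau^c}|b_l(y)-(b_l)_Q||f(y)|dy\Big)\chi_Q(x).$$ *)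

theory Defs
  imports "HOL-Analysis.Analysis"
begin

text \<open>Real powers of extended nonnegative reals (only used with positive exponents).\<close>
definition epow :: "ennreal \<Rightarrow> real \<Rightarrow> ennreal" where
  "epow x r = (if x = \<infinity> then \<infinity> else ennreal (enn2real x powr r))"

definition young_fun :: "(real \<Rightarrow> real) \<Rightarrow> bool" where
  "young_fun A \<longleftrightarrow> A 0 = 0 \<and> mono_on {0..} A \<and> convex_on {0..} A
     \<and> filterlim (\<lambda>t. A t / t) at_top at_top"

definition assoc_young :: "(real \<Rightarrow> real) \<Rightarrow> real \<Rightarrow> real" where
  "assoc_young A s = (SUP t\<in>{0..}. s * t - A t)"

definition B_cond :: "real \<Rightarrow> real \<Rightarrow> (real \<Rightarrow> real) \<Rightarrow> bool" where
  "B_cond p q A \<longleftrightarrow>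
     (\<integral>\<^sup>+ t. indicator {1..} t * ennreal (A t powr (q / p) / t powr q / t) \<partial>lborel) < \<infinity>"

definition conj_exp :: "real \<Rightarrow> real" where
  "conj_exp r = r / (r - 1)"

definition lux_norm :: "(real \<Rightarrow> real) \<Rightarrow> ('a::euclidean_space \<Rightarrow> real) \<Rightarrow> 'a set \<Rightarrow> ennreal" where
  "lux_norm A f Q = Inf {ennreal lam | lam. lam > 0 \<and>
      (\<integral>\<^sup>+ x. indicator Q x * ennreal (A (\<bar>f x\<bar> / lam)) \<partial>lebesgue) / ennreal (measure lebesgue Q) \<le> 1}"

definition dyadic_cube :: "'a::euclidean_space set \<Rightarrow> bool" where
  "dyadic_cube Q \<longleftrightarrow> (\<exists>(k::int) (j::'a \<Rightarrow> int).
     Q = {x. \<forall>i\<in>Basis. real_of_int (j i) / 2 powr k \<le> x \<bullet> i \<and> x \<bullet> i < real_of_int (j i + 1) / 2 powr k})"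

definition sparse_family :: "real \<Rightarrow> 'a::euclidean_space set set \<Rightarrow> bool" where
  "sparse_family \<eta> S \<longleftrightarrow> 0 < \<eta> \<and> \<eta> < 1 \<and> (\<exists>E. disjoint_family_on E S \<and>
      (\<forall>Q\<in>S. E Q \<subseteq> Q \<and> E Q \<in> sets lebesgue \<and> measure lebesgue (E Q) \<ge> \<eta> * measure lebesgue Q))"

definition loc_integrable :: "('a::euclidean_space \<Rightarrow> real) \<Rightarrow> bool" where
  "loc_integrable g \<longleftrightarrow> (\<forall>K. compact K \<longrightarrow> set_integrable lebesgue K g)"

definition weight :: "('a::euclidean_space \<Rightarrow> real) \<Rightarrow> bool" where
  "weight w \<longleftrightarrow> (\<forall>x. 0 \<le> w x) \<and> loc_integrable w"

definition weight_pair :: "('a::euclidean_space \<Rightarrow> real) \<Rightarrow> ('a \<Rightarrow> real) \<Rightarrow> bool" where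
  "weight_pair u v \<longleftrightarrow> weight u \<and> weight v \<and>
     emeasure lebesgue {x. u x > 0} > 0 \<and> (AE x in lebesgue. v x > 0)"

definition avg :: "('a::euclidean_space \<Rightarrow> real) \<Rightarrow> 'a set \<Rightarrow> real" where
  "avg b Q = (LINT y:Q|lebesgue. b y) / measure lebesgue Q"

definition sparse_op :: "real \<Rightarrow> nat \<Rightarrow> nat set \<Rightarrow> 'a::euclidean_space set set \<Rightarrow>
    (nat \<Rightarrow> 'a \<Rightarrow> real) \<Rightarrow> ('a \<Rightarrow> real) \<Rightarrow> 'a \<Rightarrow> ennreal" where
  "sparse_op \<alpha> m \<tau> S b f x = (\<integral>\<^sup>+ Q. ennreal (measure lebesgue Q powr (\<alpha> / real DIM('a)))
      * ennreal (\<Prod>i\<in>\<tau>. \<bar>b i x - avg (b i) Q\<bar>)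
      * ((\<integral>\<^sup>+ y. indicator Q y * ennreal ((\<Prod>l\<in>{1..m} - \<tau>. \<bar>b l y - avg (b l) Q\<bar>) * \<bar>f y\<bar>) \<partial>lebesgue)
          / ennreal (measure lebesgue Q))
      * indicator Q x \<partial>count_space S)"

definition wLp_norm :: "real \<Rightarrow> ('a::euclidean_space \<Rightarrow> real) \<Rightarrow> ('a \<Rightarrow> real) \<Rightarrow> ennreal" where
  "wLp_norm p w g = epow (\<integral>\<^sup>+ x. ennreal (\<bar>g x\<bar> powr p * w x) \<partial>lebesgue) (1 / p)"

definition wLp_norm_enn :: "real \<Rightarrow> ('a::euclidean_space \<Rightarrow> real) \<Rightarrow> ('a \<Rightarrow> ennreal) \<Rightarrow> ennreal" where
  "wLp_norm_enn p w g = epow (\<integral>\<^sup>+ x. epow (g x) p * ennreal (w x) \<partial>lebesgue) (1 / p)"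

definition K_const :: "real \<Rightarrow> real \<Rightarrow> real \<Rightarrow> nat \<Rightarrow> nat set \<Rightarrow> (real \<Rightarrow> real) \<Rightarrow> (real \<Rightarrow> real) \<Rightarrow>
    'a::euclidean_space set set \<Rightarrow> (nat \<Rightarrow> 'a \<Rightarrow> real) \<Rightarrow> ('a \<Rightarrow> real) \<Rightarrow> ('a \<Rightarrow> real) \<Rightarrow> ennreal" where
  "K_const \<alpha> p q m \<tau> A B S b u v = (SUP Q\<in>S.
      ennreal (measure lebesgue Q powr (\<alpha> / real DIM('a) + 1 / q - 1 / p))
      * lux_norm A (\<lambda>x. (\<Prod>i\<in>\<tau>. b i x - avg (b i) Q) * u x powr (1 / q)) Q
      * lux_norm B (\<lambda>x. (\<Prod>l\<in>{1..m} - \<tau>. b l x - avg (b l) Q) * v x powr (- 1 / p)) Q)"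

end

theory Submission
  imports Defs
begin

text \<open>
  By duality it suffices to bound \<open>\<integral> T f u\<^bsup>1/q\<^esup> g\<close> for \<open>g \<ge> 0\<close> in \<open>L\<^bsup>q'\<^esup>\<close>. On each cube, the
  Hoelder inequality for Luxemburg norms is applied twice, to \<open>A\<close> and \<open>B\<close> and their associates;
  the norms involving the weights are absorbed by \<open>K\<close>, and sparseness replaces \<open>|Q|\<close> by \<open>|E\<^sub>Q|\<close>. Hoelder with
  exponents \<open>s, s'\<close> for the sum over the cubes leaves two Carleson-type sums
  \<open>\<Sum> |E\<^sub>Q| |Q|\<^bsup>s/p-1\<^esup> (\<parallel>h\<parallel>\<^bsub>\<Phi>,Q\<^esub>)\<^sup>s\<close>, to be bounded by \<open>(\<parallel>h\<parallel>\<^sub>p)\<^sup>s\<close> when \<open>\<Phi> \<in> B\<^bsub>p,s\<^esub>\<close>.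

  For the latter, write \<open>(\<parallel>h\<parallel>\<^bsub>\<Phi>,Q\<^esub>)\<^sup>s\<close> as an integral over levels \<open>1/t\<close>. The cubes with
  \<open>\<parallel>h\<parallel>\<^bsub>\<Phi>,Q\<^esub> > 1/t\<close> satisfy \<open>|Q| \<le> 2 \<integral>\<^bsub>Q \<inter> {|h| t > c}\<^esub> \<Phi>(|h| t)\<close>, and since dyadic cubes are nested or
  disjoint, the same bound \<open>W t = 2 \<integral>\<^bsub>{|h| t > c}\<^esub> \<Phi>(|h| t)\<close> holds for the measure of their union; so they
  contribute at most \<open>(W t)\<^bsup>s/p\<^esup>\<close>. Minkowski's integral inequality with exponent \<open>s/p\<close> moves the
  level integral inside, where scaling turns it into the integral defining \<open>B\<^bsub>p,s\<^esub>\<close>.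
\<close>

section \<open>Powers and integral inequalities for extended nonnegative functions\<close>

lemma epow_top [simp]: "epow top r = top"
  by (simp add: epow_def)

lemma epow_ennreal: "0 \<le> t \<Longrightarrow> epow (ennreal t) r = ennreal (t powr r)"
  by (simp add: epow_def)

lemma epow_0 [simp]: "epow 0 r = 0"
  by (simp add: epow_def)

lemma epow_1 [simp]: "epow x 1 = x"
  by (cases x) (auto simp: epow_def)

lemma epow_mono: "0 < r \<Longrightarrow> x \<le> y \<Longrightarrow> epow x r \<le> epow y r"
  by (cases x; cases y) (auto simp: epow_ennreal top_unique intro!: ennreal_leI powr_mono2)

lemma epow_mult: "0 < r \<Longrightarrow> epow (x * y) r = epow x r * epow y r"
  by (cases x; cases y)
    (auto simp: epow_ennreal ennreal_mult[symmetric] powr_mult ennreal_top_mult ennreal_mult_top)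

lemma epow_add: "0 < r \<Longrightarrow> 0 < s \<Longrightarrow> epow x (r + s) = epow x r * epow x s"
  by (cases x) (auto simp: epow_ennreal ennreal_mult[symmetric] powr_add)

lemma epow_epow: "epow (epow x r) s = epow x (r * s)"
  by (cases x) (auto simp: epow_ennreal powr_powr)

lemma epow_eq_0_iff [simp]: "epow x r = 0 \<longleftrightarrow> x = 0"
  by (cases x) (auto simp: epow_ennreal)

lemma epow_eq_top_iff [simp]: "epow x r = top \<longleftrightarrow> x = top"
  by (cases x) (auto simp: epow_ennreal)

lemma epow_le_iff: "0 < r \<Longrightarrow> epow x r \<le> y \<longleftrightarrow> x \<le> epow y (1 / r)"
  using epow_mono[of "1/r" "epow x r" y] epow_mono[of r x "epow y (1/r)"]
  by (auto simp: epow_epow)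

text \<open>Taking the power \<open>1 / r\<close> is a monotone inverse, so
  \<open>epow_le_iff\<close> is a Galois connection, and a lower adjoint preserves suprema.\<close>

lemma epow_SUP: "0 < r \<Longrightarrow> epow (SUP i\<in>I. f i) r = (SUP i\<in>I. epow (f i) r)"
proof (rule antisym)
  assume r: "0 < r"
  show "epow (SUP i\<in>I. f i) r \<le> (SUP i\<in>I. epow (f i) r)"
    unfolding epow_le_iff[OF r]
    by (rule SUP_least) (auto simp: epow_le_iff[OF r, symmetric] intro: SUP_upper)
qed (auto intro!: SUP_least epow_mono intro: SUP_upper)

lemma measurable_epow [measurable (raw)]:
  assumes [measurable]: "f \<in> borel_measurable M"
  shows "(\<lambda>x. epow (f x) r) \<in> borel_measurable M"
  unfolding epow_def by measurable

section \<open>The inequalities of Young, Hoelder and Minkowski\<close>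

lemma Youngs_inequality_ennreal:
  fixes x y :: ennreal
  assumes "1 < p" "1 / p + 1 / q = 1"
  shows "x * y \<le> ennreal (1 / p) * epow x p + ennreal (1 / q) * epow y q"
proof -
  have q: "1 < q" using assms
    by (smt (verit, ccfv_SIG) divide_less_eq_1 zero_less_divide_1_iff divide_le_0_1_iff)
  show ?thesis
  proof (cases "x = top \<or> y = top")
    case True
    then show ?thesis using assms q by (auto simp: ennreal_mult_top)
  next
    case False
    then obtain a b where "x = ennreal a" "0 \<le> a" "y = ennreal b" "0 \<le> b"
      by (metis ennreal_cases)
    then show ?thesis
      using Youngs_inequality[of p q a b] assms q
      by (auto simp: epow_ennreal ennreal_mult[symmetric] ennreal_plus[symmetric] simp del: ennreal_plus
          intro!: ennreal_leI)
  qed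
qed

text \<open>Young's inequality is integrated after both functions are normalised to norm 1.
  Degenerate norms are split off first: a zero norm makes the product vanish almost everywhere, and
  because \<open>0 * top = 0\<close>, an infinite norm makes the right-hand side infinite only if
  the other norm is nonzero.\<close>

lemma nn_integral_Hoelder:
  fixes f g :: "'a \<Rightarrow> ennreal"
  assumes [measurable]: "f \<in> borel_measurable M" "g \<in> borel_measurable M"
    and p: "1 < p" "1 / p + 1 / q = 1"
  shows "(\<integral>\<^sup>+x. f x * g x \<partial>M)
    \<le> epow (\<integral>\<^sup>+x. epow (f x) p \<partial>M) (1 / p) * epow (\<integral>\<^sup>+x. epow (g x) q \<partial>M) (1 / q)"
proof -
  define F where "F = (\<integral>\<^sup>+x. epow (f x) p \<partial>M)"
  define G where "G = (\<integral>\<^sup>+x. epow (g x) q \<partial>M)"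
  have q: "1 < q" using p
    by (smt (verit, ccfv_SIG) divide_less_eq_1 zero_less_divide_1_iff divide_le_0_1_iff)
  consider "F = 0" | "G = 0" | "F \<noteq> 0" "G \<noteq> 0" "F = top \<or> G = top"
    | "F \<noteq> 0" "G \<noteq> 0" "F \<noteq> top" "G \<noteq> top" by blast
  then show ?thesis
  proof cases
    case 1
    then have "AE x in M. f x = 0"
      by (simp add: F_def nn_integral_0_iff_AE)
    then have "(\<integral>\<^sup>+x. f x * g x \<partial>M) = (\<integral>\<^sup>+x. 0 \<partial>M)"
      by (intro nn_integral_cong_AE) auto
    then show ?thesis by simp
  next
    case 2
    then have "AE x in M. g x = 0"
      by (simp add: G_def nn_integral_0_iff_AE)
    then have "(\<integral>\<^sup>+x. f x * g x \<partial>M) = (\<integral>\<^sup>+x. 0 \<partial>M)"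
      by (intro nn_integral_cong_AE) auto
    then show ?thesis by simp
  next
    case 3
    then show ?thesis
      unfolding F_def[symmetric] G_def[symmetric]
      by (auto simp: ennreal_mult_top ennreal_top_mult)
  next
    case 4
    then obtain a b where ab: "F = ennreal a" "0 < a" "G = ennreal b" "0 < b"
      by (metis ennreal_cases ennreal_0 le_less)
    define a' b' where "a' = a powr (1 / p)" and "b' = b powr (1 / q)"
    have pos: "0 < a'" "0 < b'" using ab by (auto simp: a'_def b'_def)
    have ab': "a' powr p = a" "b' powr q = b"
      using ab p q by (auto simp: a'_def b'_def powr_powr)
    have "(\<integral>\<^sup>+x. (ennreal (1 / a') * f x) * (ennreal (1 / b') * g x) \<partial>M)
      \<le> (\<integral>\<^sup>+x. ennreal (1 / p) * epow (ennreal (1 / a') * f x) p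
             + ennreal (1 / q) * epow (ennreal (1 / b') * g x) q \<partial>M)"
      by (intro nn_integral_mono Youngs_inequality_ennreal p)
    also have "\<dots> = ennreal (1 / p) * (ennreal (1 / a) * F) + ennreal (1 / q) * (ennreal (1 / b) * G)"
      using pos p q ab' unfolding F_def G_def
      by (simp add: nn_integral_add nn_integral_cmult epow_mult epow_ennreal powr_divide)
    also have "\<dots> = ennreal (1 / p) + ennreal (1 / q)"
      using ab p q by (simp add: ennreal_mult[symmetric])
    also have "\<dots> = 1" using p q by (simp add: ennreal_plus[symmetric] del: ennreal_plus)
    also have "(\<integral>\<^sup>+x. (ennreal (1 / a') * f x) * (ennreal (1 / b') * g x) \<partial>M)
      = (\<integral>\<^sup>+x. ennreal (1 / a') * ennreal (1 / b') * (f x * g x) \<partial>M)"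
      by (intro nn_integral_cong) (simp add: mult_ac)
    also have "\<dots> = ennreal (1 / (a' * b')) * (\<integral>\<^sup>+x. f x * g x \<partial>M)"
      using pos by (subst nn_integral_cmult) (auto simp: ennreal_mult[symmetric])
    finally have "ennreal (a' * b') * (ennreal (1 / (a' * b')) * (\<integral>\<^sup>+x. f x * g x \<partial>M)) \<le> ennreal (a' * b') * 1"
      by (rule mult_left_mono) auto
    moreover have "ennreal (a' * b') * (ennreal (1 / (a' * b')) * X) = X" for X
      using pos by (simp add: mult.assoc[symmetric] ennreal_mult[symmetric])
    moreover have "epow F (1 / p) * epow G (1 / q) = ennreal (a' * b')"
      using ab by (simp add: epow_ennreal a'_def b'_def ennreal_mult)
    ultimately show ?thesis by (simp add: F_def G_def)
  qed
qed

text \<open>The test functions are the powers \<open>H\<^bsup>p-1\<^esup>\<close> of truncations \<open>H\<close> of \<open>G\<close> for which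
  both sides are finite.\<close>
lemma nn_integral_converse_Hoelder:
  fixes G :: "'a \<Rightarrow> ennreal"
  assumes "sigma_finite_measure M"
    and [measurable]: "G \<in> borel_measurable M"
    and p: "1 < p" "1 / p + 1 / q = 1"
    and bound: "\<And>g :: 'a \<Rightarrow> real. g \<in> borel_measurable M \<Longrightarrow> (\<And>x. 0 \<le> g x) \<Longrightarrow>
      (\<integral>\<^sup>+x. G x * ennreal (g x) \<partial>M) \<le> C * epow (\<integral>\<^sup>+x. epow (ennreal (g x)) q \<partial>M) (1 / q)"
  shows "epow (\<integral>\<^sup>+x. epow (G x) p \<partial>M) (1 / p) \<le> C"
proof -
  interpret sigma_finite_measure M by fact
  obtain A :: "nat \<Rightarrow> 'a set" where A: "range A \<subseteq> sets M" "(\<Union>i. A i) = space M"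
    "\<And>i. emeasure M (A i) \<noteq> \<infinity>" "incseq A"
    using sigma_finite_incseq by blast
  have [measurable]: "A i \<in> sets M" for i using A by auto
  have q: "1 < q" using p
    by (smt (verit, ccfv_SIG) divide_less_eq_1 zero_less_divide_1_iff divide_le_0_1_iff)
  \<comment> \<open>By this identity the \<open>q\<close>-th power of the test function
    \<open>H^(p-1)\<close> is again \<open>H^p\<close>.\<close>
  have pq: "(p - 1) * q = p" using p q by (simp add: field_simps)
  \<comment> \<open>Truncating the height and also the support, to sets of finite measure, makes the
    integral of \<open>H^p\<close> finite while \<open>H n\<close> still increases to
    \<open>G\<close>.\<close>
  define H where "H n x = min (G x) (of_nat n) * indicator (A n) x" for n x
  have [measurable]: "H n \<in> borel_measurable M" for n unfolding H_def by measurable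
  have HG: "H n x \<le> G x" for n x by (auto simp: H_def split: split_indicator)
  have H_fin: "H n x \<noteq> top" for n x
  proof -
    have "H n x \<le> of_nat n" by (auto simp: H_def split: split_indicator)
    then show ?thesis using le_less_trans of_nat_less_top by (metis less_irrefl)
  qed
  have incH: "H m x \<le> H n x" if "m \<le> n" for m n x
  proof -
    have "A m \<subseteq> A n" using A that by (auto simp: incseq_def)
    moreover have "min (G x) (of_nat m) \<le> min (G x) (of_nat n)"
      using that by (intro min.mono) auto
    ultimately show ?thesis unfolding H_def by (auto split: split_indicator)
  qed
  have SUP_H: "(SUP n. H n x) = G x" if x: "x \<in> space M" for x
  proof (rule antisym)
    show "(SUP n. H n x) \<le> G x" by (rule SUP_least) (rule HG)
    obtain k where k: "x \<in> A k" using A x by blast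
    \<comment> \<open>It suffices to reach every \<open>y\<close> below \<open>G x\<close>. Such a
      \<open>y\<close> is finite even if \<open>G x\<close> is not, so a single truncation already
      reaches it.\<close>
    show "G x \<le> (SUP n. H n x)"
    proof (rule dense_le)
      fix y assume y: "y < G x"
      then have "y < top" by (metis order_less_le_trans top_greatest)
      then obtain r where r: "y = ennreal r" "0 \<le> r" by (cases y) auto
      obtain n where n: "r \<le> real n" using real_arch_simple by blast
      define N where "N = max n k"
      have "x \<in> A N" using k A(4) max.cobounded2 unfolding N_def incseq_def by blast
      moreover have "y \<le> of_nat N"
      proof -
        have "y \<le> ennreal (real N)" using r n by (auto simp: N_def intro!: ennreal_leI)
        then show ?thesis by (simp add: ennreal_of_nat_eq_real_of_nat)
      qed
      ultimately have "y \<le> H N x" using y by (simp add: H_def)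
      also have "\<dots> \<le> (SUP n. H n x)" by (rule SUP_upper) simp
      finally show "y \<le> (SUP n. H n x)" .
    qed
  qed
  have X: "(\<integral>\<^sup>+x. epow (H n x) p \<partial>M) \<le> epow C p" for n
  proof -
    define X where "X = (\<integral>\<^sup>+x. epow (H n x) p \<partial>M)"
    have "X \<le> (\<integral>\<^sup>+x. epow (of_nat n) p * indicator (A n) x \<partial>M)"
      unfolding X_def H_def using p
      by (intro nn_integral_mono) (auto split: split_indicator intro!: epow_mono)
    also have "\<dots> < top"
      using A(3)[of n] by (simp add: nn_integral_cmult_indicator ennreal_mult_less_top less_top)
          (simp add: less_top[symmetric])
    finally have fin: "X \<noteq> top" by simp
    have "X = (\<integral>\<^sup>+x. H n x * epow (H n x) (p - 1) \<partial>M)"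
      unfolding X_def using p epow_add[of 1 "p - 1"] by simp
    also have "\<dots> \<le> (\<integral>\<^sup>+x. G x * epow (H n x) (p - 1) \<partial>M)"
      by (intro nn_integral_mono mult_right_mono HG) auto
    also have "\<dots> \<le> C * epow (\<integral>\<^sup>+x. epow (epow (H n x) (p - 1)) q \<partial>M) (1 / q)"
    proof -
      \<comment> \<open>\<open>bound\<close> speaks of real-valued test functions; the passage
        through \<open>enn2real\<close> loses nothing because \<open>H n\<close> is finite.\<close>
      have "ennreal (enn2real (epow (H n x) (p - 1))) = epow (H n x) (p - 1)" for x
        using H_fin by (simp add: less_top[symmetric])
      then show ?thesis using bound[of "\<lambda>x. enn2real (epow (H n x) (p - 1))"] by simp
    qed
    also have "\<dots> = C * epow X (1 / q)" by (simp add: epow_epow pq X_def)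
    finally have le: "X \<le> C * epow X (1 / q)" .
    \<comment> \<open>Dividing \<open>X \<le> C X^(1/q)\<close> by \<open>X^(1/q)\<close> leaves
      \<open>X^(1/p)\<close> on the left. This is where the finiteness of \<open>X\<close>
      enters.\<close>
    have "epow X (1 / p) \<le> C"
    proof (cases "X = 0")
      case False
      have "epow X (1 / q) * epow X (1 / p) \<le> epow X (1 / q) * C"
        using le epow_add[of "1/q" "1/p" X] p q by (simp add: add.commute mult.commute)
      then show ?thesis
        using False fin by (subst (asm) ennreal_mult_le_mult_iff) auto
    qed simp
    then show ?thesis using epow_le_iff[of "1/p" X C] p by (simp add: X_def)
  qed
  have "(\<integral>\<^sup>+x. epow (G x) p \<partial>M) = (\<integral>\<^sup>+x. (SUP n. epow (H n x) p) \<partial>M)"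
    using p by (intro nn_integral_cong) (simp add: SUP_H epow_SUP[symmetric])
  also have "\<dots> = (SUP n. (\<integral>\<^sup>+x. epow (H n x) p \<partial>M))"
    using p by (intro nn_integral_monotone_convergence_SUP)
      (auto simp: incseq_def le_fun_def intro!: epow_mono incH)
  also have "\<dots> \<le> epow C p" by (rule SUP_least) (rule X)
  finally show ?thesis using epow_le_iff[of "1/p"] p by simp
qed

text \<open>Duality makes the claim linear in the inner integral: against a test function
  \<open>g\<close> the integrals can be exchanged, and Hoelder in \<open>y\<close> for each fixed
  \<open>x\<close> produces the right-hand side. The converse Hoelder inequality then removes
  \<open>g\<close>.\<close>

lemma nn_integral_Minkowski:
  fixes F :: "'a \<Rightarrow> 'b \<Rightarrow> ennreal"
  assumes M: "sigma_finite_measure M" and N: "sigma_finite_measure N"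
    and [measurable]: "(\<lambda>(x, y). F x y) \<in> borel_measurable (M \<Otimes>\<^sub>M N)"
    and r: "1 \<le> r"
  shows "epow (\<integral>\<^sup>+y. epow (\<integral>\<^sup>+x. F x y \<partial>M) r \<partial>N) (1 / r)
    \<le> (\<integral>\<^sup>+x. epow (\<integral>\<^sup>+y. epow (F x y) r \<partial>N) (1 / r) \<partial>M)"
proof -
  interpret M: sigma_finite_measure M by fact
  interpret N: sigma_finite_measure N by fact
  interpret pair_sigma_finite M N ..
  have Fub: "(\<integral>\<^sup>+y. (\<integral>\<^sup>+x. f x y \<partial>M) \<partial>N) = (\<integral>\<^sup>+x. (\<integral>\<^sup>+y. f x y \<partial>N) \<partial>M)"
    if "case_prod f \<in> borel_measurable (M \<Otimes>\<^sub>M N)" for f :: "'a \<Rightarrow> 'b \<Rightarrow> ennreal"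
    using that by (rule Fubini')
  show ?thesis
  \<comment> \<open>For \<open>r = 1\<close> there is no finite conjugate exponent, but both sides
    agree by Tonelli.\<close>
  proof (cases "r = 1")
    case True
    then show ?thesis by (simp add: Fub)
  next
    case False
    with r have r: "1 < r" by simp
    define r' where "r' = r / (r - 1)"
    have r': "1 / r + 1 / r' = 1" using r by (simp add: r'_def field_simps)
    show ?thesis
    proof (rule nn_integral_converse_Hoelder[OF N _ r r'])
      show "(\<lambda>y. \<integral>\<^sup>+x. F x y \<partial>M) \<in> borel_measurable N" by measurable
      fix g' :: "'b \<Rightarrow> real" assume [measurable]: "g' \<in> borel_measurable N"
      define g where "g y = ennreal (g' y)" for y
      have [measurable]: "g \<in> borel_measurable N" unfolding g_def by measurable
      have "(\<integral>\<^sup>+y. (\<integral>\<^sup>+x. F x y \<partial>M) * g y \<partial>N) = (\<integral>\<^sup>+y. (\<integral>\<^sup>+x. F x y * g y \<partial>M) \<partial>N)"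
        by (intro nn_integral_cong) (simp add: nn_integral_multc)
      also have "\<dots> = (\<integral>\<^sup>+x. (\<integral>\<^sup>+y. F x y * g y \<partial>N) \<partial>M)"
        by (rule Fub) measurable
      also have "\<dots> \<le> (\<integral>\<^sup>+x. epow (\<integral>\<^sup>+y. epow (F x y) r \<partial>N) (1 / r)
          * epow (\<integral>\<^sup>+y. epow (g y) r' \<partial>N) (1 / r') \<partial>M)"
        by (intro nn_integral_mono nn_integral_Hoelder r r') auto
      also have "\<dots> = (\<integral>\<^sup>+x. epow (\<integral>\<^sup>+y. epow (F x y) r \<partial>N) (1 / r) \<partial>M)
          * epow (\<integral>\<^sup>+y. epow (g y) r' \<partial>N) (1 / r')"
        by (rule nn_integral_multc) measurable
      finally show "(\<integral>\<^sup>+y. (\<integral>\<^sup>+x. F x y \<partial>M) * ennreal (g' y) \<partial>N)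
        \<le> (\<integral>\<^sup>+x. epow (\<integral>\<^sup>+y. epow (F x y) r \<partial>N) (1 / r) \<partial>M)
          * epow (\<integral>\<^sup>+y. epow (ennreal (g' y)) r' \<partial>N) (1 / r')" by (simp add: g_def)
    qed
  qed
qed

section \<open>Young functions and Luxemburg norms\<close>

text \<open>These properties are shared by a Young function and its associate, so norm estimates can
  be proved once for both. The last clause is convexity along the segment from \<open>0\<close> to
  \<open>t\<close>.\<close>

definition orlicz_fun :: "(real \<Rightarrow> real) \<Rightarrow> bool" where
  "orlicz_fun \<Phi> \<longleftrightarrow> \<Phi> 0 = 0 \<and> mono_on {0..} \<Phi> \<and>
     (\<forall>\<theta> t. 0 \<le> \<theta> \<longrightarrow> \<theta> \<le> 1 \<longrightarrow> 0 \<le> t \<longrightarrow> \<Phi> (\<theta> * t) \<le> \<theta> * \<Phi> t)"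

lemma orlicz_fun_mono: "orlicz_fun \<Phi> \<Longrightarrow> 0 \<le> s \<Longrightarrow> s \<le> t \<Longrightarrow> \<Phi> s \<le> \<Phi> t"
  by (auto simp: orlicz_fun_def mono_on_def)

lemma orlicz_fun_nonneg: "orlicz_fun \<Phi> \<Longrightarrow> 0 \<le> t \<Longrightarrow> 0 \<le> \<Phi> t"
  using orlicz_fun_mono[of \<Phi> 0 t] by (simp add: orlicz_fun_def)

lemma orlicz_fun_scale:
  "orlicz_fun \<Phi> \<Longrightarrow> 0 \<le> \<theta> \<Longrightarrow> \<theta> \<le> 1 \<Longrightarrow> 0 \<le> t \<Longrightarrow> \<Phi> (\<theta> * t) \<le> \<theta> * \<Phi> t"
  by (auto simp: orlicz_fun_def)

lemma borel_measurable_orlicz_fun: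
  assumes \<Phi>: "orlicz_fun \<Phi>" and [measurable]: "g \<in> borel_measurable M"
    and nonneg: "\<And>x. 0 \<le> g x"
  shows "(\<lambda>x. \<Phi> (g x)) \<in> borel_measurable M"
proof -
  \<comment> \<open>Monotonicity is known on \<open>[0, \<infinity>)\<close> only; composing with
    \<open>max 0\<close> makes it global, and monotone functions are Borel.\<close>
  have "mono (\<lambda>t. \<Phi> (max 0 t))"
    by (intro monoI orlicz_fun_mono[OF \<Phi>]) auto
  then have [measurable]: "(\<lambda>t. \<Phi> (max 0 t)) \<in> borel_measurable borel"
    by (rule borel_measurable_mono)
  have "(\<lambda>x. \<Phi> (max 0 (g x))) \<in> borel_measurable M" by measurable
  then show ?thesis using nonneg by (simp add: max_absorb2)
qed

section \<open>Young functions and their associates\<close>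

lemma orlicz_fun_young: "young_fun A \<Longrightarrow> orlicz_fun A"
  unfolding orlicz_fun_def young_fun_def
proof safe
  fix \<theta> t :: real
  assume "A 0 = 0" "convex_on {0..} A" "0 \<le> \<theta>" "\<theta> \<le> 1" "0 \<le> t"
  then show "A (\<theta> * t) \<le> \<theta> * A t"
    using convex_onD[of "{0..}" A \<theta> 0 t] by simp
qed

text \<open>Superlinear growth of \<open>A\<close> keeps the supremum in \<open>assoc_young\<close>
  meaningful: beyond some \<open>T\<close> the value \<open>s * t - A t\<close> is at most 0, and
  before \<open>T\<close> it is at most \<open>|s| |T|\<close>.\<close>

lemma bdd_above_assoc_young:
  assumes A: "young_fun A"
  shows "bdd_above ((\<lambda>t. s * t - A t) ` {0..})"
proof -
  have "eventually (\<lambda>t. s \<le> A t / t) at_top"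
    using A by (auto simp: young_fun_def filterlim_at_top)
  then obtain T where T: "\<And>t. T \<le> t \<Longrightarrow> s \<le> A t / t"
    by (auto simp: eventually_at_top_linorder)
  show ?thesis
  proof (rule bdd_aboveI2)
    fix t :: real assume "t \<in> {0..}"
    then have t: "0 \<le> t" by simp
    have A0: "0 \<le> A t" using orlicz_fun_nonneg[OF orlicz_fun_young[OF A] t] .
    show "s * t - A t \<le> \<bar>s\<bar> * \<bar>T\<bar>"
    proof (cases "T \<le> t \<and> 0 < t")
      case True
      then have "s * t \<le> A t" using T[of t] by (simp add: field_simps)
      moreover have "0 \<le> \<bar>s\<bar> * \<bar>T\<bar>" by simp
      ultimately show ?thesis by linarith
    next
      case False
      then have "t \<le> \<bar>T\<bar>" using t by auto
      then have "\<bar>s\<bar> * t \<le> \<bar>s\<bar> * \<bar>T\<bar>" by (intro mult_left_mono) auto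
      moreover have "s * t \<le> \<bar>s\<bar> * t" using t by (intro mult_right_mono) auto
      ultimately show ?thesis using A0 by linarith
    qed
  qed
qed

lemma assoc_young_inequality:
  assumes "young_fun A" "0 \<le> t"
  shows "t * s \<le> A t + assoc_young A s"
proof -
  have "s * t - A t \<le> assoc_young A s"
    unfolding assoc_young_def
    by (rule cSUP_upper) (use assms bdd_above_assoc_young in auto)
  then show ?thesis by (simp add: mult.commute)
qed

lemma assoc_young_least:
  "(\<And>t. 0 \<le> t \<Longrightarrow> s * t - A t \<le> c) \<Longrightarrow> assoc_young A s \<le> c"
  unfolding assoc_young_def by (rule cSUP_least) auto

text \<open>The associate is a supremum of functions of \<open>s\<close> that are affine with slope
  \<open>t \<ge> 0\<close>, hence monotone. The scaling property follows from
  \<open>A \<ge> 0\<close>, because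
  \<open>\<theta> s t - A t \<le> \<theta> (s t - A t)\<close>.\<close>

lemma orlicz_fun_assoc_young:
  assumes A: "young_fun A"
  shows "orlicz_fun (assoc_young A)"
  unfolding orlicz_fun_def
proof (intro conjI allI impI)
  note nonneg = orlicz_fun_nonneg[OF orlicz_fun_young[OF A]]
  note young = assoc_young_inequality[OF A]
  have "A 0 = 0" using A by (simp add: young_fun_def)
  then have ge: "0 \<le> assoc_young A s" for s using young[of 0 s] by simp
  show "assoc_young A 0 = 0"
    by (intro antisym ge assoc_young_least) (simp add: nonneg)
  show "mono_on {0..} (assoc_young A)"
  proof (intro mono_onI assoc_young_least)
    fix r s t :: real assume "r \<le> s" "0 \<le> t"
    then have "r * t \<le> s * t" by (intro mult_right_mono)
    then show "r * t - A t \<le> assoc_young A s" using young[of t s] \<open>0 \<le> t\<close> by (simp add: mult.commute)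
  qed
  fix \<theta> s :: real assume \<theta>: "0 \<le> \<theta>" "\<theta> \<le> 1"
  show "assoc_young A (\<theta> * s) \<le> \<theta> * assoc_young A s"
  proof (rule assoc_young_least)
    fix t :: real assume t: "0 \<le> t"
    have "\<theta> * (t * s) \<le> \<theta> * (A t + assoc_young A s)"
      using young[OF t] \<theta> by (intro mult_left_mono)
    moreover have "\<theta> * A t \<le> A t" using \<theta> nonneg[OF t] by (simp add: mult_left_le_one_le)
    ultimately show "\<theta> * s * t - A t \<le> \<theta> * assoc_young A s"
      by (simp add: algebra_simps)
  qed
qed

section \<open>The Hoelder inequality for Luxemburg norms\<close>

lemma ennreal_mult_divide_cancel: "0 < x \<Longrightarrow> x < top \<Longrightarrow> x * (z / x) = (z :: ennreal)"
  by (metis ennreal_times_divide mult.commute mult_divide_eq_ennreal less_irrefl)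

lemma ennreal_divide_le_imp_le_mult:
  fixes x y z :: ennreal
  assumes "z / x \<le> y" "0 < x" "x < top"
  shows "z \<le> x * y"
  using mult_left_mono[OF assms(1), of x] ennreal_mult_divide_cancel[OF assms(2,3), of z] by simp

text \<open>The infima are taken one factor at a time, dividing by the other factor, which must be
  positive and finite. The last two premises handle a vanishing infimum: as
  \<open>0 * top = 0\<close>, the right-hand side can then be 0 although every product
  \<open>a * b\<close> is large.\<close>

lemma le_Inf_mult_ennreal:
  fixes X :: ennreal
  assumes X: "\<And>a b. a \<in> S \<Longrightarrow> b \<in> T \<Longrightarrow> X \<le> a * b"
    and S: "\<And>a. a \<in> S \<Longrightarrow> 0 < a \<and> a < top" and T: "\<And>b. b \<in> T \<Longrightarrow> 0 < b \<and> b < top"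
    and 0: "Inf S = 0 \<Longrightarrow> X = 0" "Inf T = 0 \<Longrightarrow> X = 0"
  shows "X \<le> Inf S * Inf T"
proof -
  consider "X = 0" | "X \<noteq> 0" "S = {} \<or> T = {}" | "X \<noteq> 0" "S \<noteq> {}" "T \<noteq> {}" by blast
  then show ?thesis
  proof cases
    case 2
    then show ?thesis using 0 by (auto simp: ennreal_mult_top ennreal_top_mult)
  next
    case 3
    have *: "0 < Inf T" using 0 3 by (auto simp: zero_less_iff_neq_zero)
    have **: "Inf T < top" using T 3 by (metis Inf_lower ex_in_conv order.strict_trans1)
    have "X \<le> a * Inf T" if a: "a \<in> S" for a
    proof (rule ennreal_divide_le_imp_le_mult)
      show "X / a \<le> Inf T"
        using S[OF a] X[OF a] by (intro Inf_greatest divide_le_posI_ennreal) auto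
    qed (use S[OF a] in auto)
    then have "X / Inf T \<le> Inf S"
      using * by (intro Inf_greatest divide_le_posI_ennreal) (simp_all add: mult.commute)
    then have "X \<le> Inf T * Inf S" using * ** by (rule ennreal_divide_le_imp_le_mult)
    then show ?thesis by (simp add: mult.commute)
  qed simp
qed

text \<open>Young's inequality for \<open>|f| / a\<close> and \<open>|g| / b\<close> is multiplied
  by \<open>a * b\<close> and integrated over \<open>Q\<close>; the factor 2 counts the two
  modulars.\<close>

lemma nn_integral_mult_le_modulars:
  fixes f g :: "'a::euclidean_space \<Rightarrow> real"
  assumes \<Phi>: "orlicz_fun \<Phi>" and \<Psi>: "orlicz_fun \<Psi>"
    and young: "\<And>a b. 0 \<le> a \<Longrightarrow> 0 \<le> b \<Longrightarrow> a * b \<le> \<Phi> a + \<Psi> b"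
    and [measurable]: "Q \<in> sets lebesgue"
    and [measurable]: "f \<in> borel_measurable lebesgue" "g \<in> borel_measurable lebesgue"
    and a: "0 < a" "(\<integral>\<^sup>+ x. indicator Q x * ennreal (\<Phi> (\<bar>f x\<bar> / a)) \<partial>lebesgue) \<le> c"
    and b: "0 < b" "(\<integral>\<^sup>+ x. indicator Q x * ennreal (\<Psi> (\<bar>g x\<bar> / b)) \<partial>lebesgue) \<le> c"
  shows "(\<integral>\<^sup>+x. indicator Q x * ennreal \<bar>f x * g x\<bar> \<partial>lebesgue) \<le> 2 * c * (ennreal a * ennreal b)"
proof -
  have [measurable]: "(\<lambda>x. \<Phi> (\<bar>f x\<bar> / a)) \<in> borel_measurable lebesgue"
    using a by (intro borel_measurable_orlicz_fun[OF \<Phi>]) auto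
  have [measurable]: "(\<lambda>x. \<Psi> (\<bar>g x\<bar> / b)) \<in> borel_measurable lebesgue"
    using b by (intro borel_measurable_orlicz_fun[OF \<Psi>]) auto
  have "(\<integral>\<^sup>+x. indicator Q x * ennreal \<bar>f x * g x\<bar> \<partial>lebesgue)
    \<le> (\<integral>\<^sup>+x. ennreal (a * b) * (indicator Q x * ennreal (\<Phi> (\<bar>f x\<bar> / a))
      + indicator Q x * ennreal (\<Psi> (\<bar>g x\<bar> / b))) \<partial>lebesgue)"
  proof (intro nn_integral_mono)
    fix x
    have nonneg: "0 \<le> \<Phi> (\<bar>f x\<bar> / a)" "0 \<le> \<Psi> (\<bar>g x\<bar> / b)"
      using a b orlicz_fun_nonneg[OF \<Phi>] orlicz_fun_nonneg[OF \<Psi>] by auto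
    have "\<bar>f x\<bar> / a * (\<bar>g x\<bar> / b) \<le> \<Phi> (\<bar>f x\<bar> / a) + \<Psi> (\<bar>g x\<bar> / b)"
      using a b by (intro young) auto
    then have "a * b * (\<bar>f x\<bar> / a * (\<bar>g x\<bar> / b)) \<le> a * b * (\<Phi> (\<bar>f x\<bar> / a) + \<Psi> (\<bar>g x\<bar> / b))"
      using a b by (intro mult_left_mono) auto
    then have "\<bar>f x * g x\<bar> \<le> a * b * (\<Phi> (\<bar>f x\<bar> / a) + \<Psi> (\<bar>g x\<bar> / b))"
      using a b by (simp add: abs_mult)
    then have "ennreal \<bar>f x * g x\<bar> \<le> ennreal (a * b * (\<Phi> (\<bar>f x\<bar> / a) + \<Psi> (\<bar>g x\<bar> / b)))"
      by (rule ennreal_leI)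
    also have "\<dots> = ennreal (a * b) * (ennreal (\<Phi> (\<bar>f x\<bar> / a)) + ennreal (\<Psi> (\<bar>g x\<bar> / b)))"
      using nonneg a b by (simp add: ennreal_mult')
    finally show "indicator Q x * ennreal \<bar>f x * g x\<bar> \<le> ennreal (a * b) *
        (indicator Q x * ennreal (\<Phi> (\<bar>f x\<bar> / a)) + indicator Q x * ennreal (\<Psi> (\<bar>g x\<bar> / b)))"
      by (cases "x \<in> Q") auto
  qed
  also have "\<dots> = ennreal (a * b) * ((\<integral>\<^sup>+ x. indicator Q x * ennreal (\<Phi> (\<bar>f x\<bar> / a)) \<partial>lebesgue)
      + (\<integral>\<^sup>+ x. indicator Q x * ennreal (\<Psi> (\<bar>g x\<bar> / b)) \<partial>lebesgue))"
    by (simp add: nn_integral_cmult nn_integral_add)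
  also have "\<dots> \<le> ennreal (a * b) * (c + c)"
    using a b by (intro mult_left_mono add_mono) auto
  also have "\<dots> = 2 * c * (ennreal a * ennreal b)"
    using a b by (simp add: ennreal_mult mult_2[symmetric] mult_ac)
  finally show ?thesis .
qed

lemma lux_norm_eq_Inf:
  fixes f :: "'a::euclidean_space \<Rightarrow> real"
  assumes "0 < measure lebesgue Q"
  shows "lux_norm \<Phi> f Q = Inf (ennreal ` {lam. 0 < lam \<and>
    (\<integral>\<^sup>+ x. indicator Q x * ennreal (\<Phi> (\<bar>f x\<bar> / lam)) \<partial>lebesgue) \<le> ennreal (measure lebesgue Q)})"
proof -
  have "X / ennreal (measure lebesgue Q) \<le> 1 \<longleftrightarrow> X \<le> ennreal (measure lebesgue Q)" for X
    using assms ennreal_divide_le_imp_le_mult[of X "ennreal (measure lebesgue Q)" 1]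
    by (auto intro!: divide_le_posI_ennreal)
  then show ?thesis unfolding lux_norm_def image_def by (intro arg_cong[where f = Inf]) auto
qed

text \<open>Pairing \<open>f\<close> with the constant 1 bounds the integral of \<open>|f|\<close>
  over \<open>Q\<close> by a fixed multiple of every admissible level \<open>a\<close>, and these
  levels come arbitrarily close to 0. This supplies the vanishing cases of the Hoelder
  inequality.\<close>

lemma lux_norm_eq_0_imp_AE:
  fixes f :: "'a::euclidean_space \<Rightarrow> real"
  assumes \<Phi>: "orlicz_fun \<Phi>" and \<Psi>: "orlicz_fun \<Psi>"
    and young: "\<And>a b. 0 \<le> a \<Longrightarrow> 0 \<le> b \<Longrightarrow> a * b \<le> \<Phi> a + \<Psi> b"
    and Q: "Q \<in> lmeasurable" and pos: "0 < measure lebesgue Q"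
    and f [measurable]: "f \<in> borel_measurable lebesgue"
    and 0: "lux_norm \<Phi> f Q = 0"
  shows "AE x in lebesgue. x \<in> Q \<longrightarrow> f x = 0"
proof -
  have [measurable]: "Q \<in> sets lebesgue" using Q by (rule fmeasurableD)
  let ?q = "ennreal (measure lebesgue Q)"
  define I where "I = (\<integral>\<^sup>+x. indicator Q x * ennreal \<bar>f x * 1\<bar> \<partial>lebesgue)"
  \<comment> \<open>Scaling gives \<open>\<Psi> (1 / b) \<le> \<Psi> 1 / b \<le> 1\<close>, so
    \<open>b\<close> is an admissible level for the constant 1.\<close>
  define b where "b = \<Psi> 1 + 1"
  have \<Psi>1: "0 \<le> \<Psi> 1" by (simp add: orlicz_fun_nonneg[OF \<Psi>])
  then have b: "0 < b" by (simp add: b_def)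
  have "\<Psi> (1 / b) \<le> 1 / b * \<Psi> 1"
    using orlicz_fun_scale[OF \<Psi>, of "1/b" 1] b \<Psi>1 by (simp add: b_def)
  also have "\<dots> \<le> 1" using \<Psi>1 by (simp add: b_def)
  finally have \<Psi>b: "\<Psi> (1 / b) \<le> 1" .
  have "(\<integral>\<^sup>+ x. indicator Q x * ennreal (\<Psi> (\<bar>1::real\<bar> / b)) \<partial>lebesgue)
    \<le> (\<integral>\<^sup>+ x. indicator Q x \<partial>lebesgue)"
    using \<Psi>b by (intro nn_integral_mono) (auto split: split_indicator)
  also have "\<dots> = ?q" using Q by (simp add: emeasure_eq_measure2)
  finally have modb: "(\<integral>\<^sup>+ x. indicator Q x * ennreal (\<Psi> (\<bar>1::real\<bar> / b)) \<partial>lebesgue) \<le> ?q" .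
  have le: "I \<le> ennreal e" if e: "0 < e" for e
  proof -
    \<comment> \<open>Chosen so that \<open>2 |Q| d b = e\<close>.\<close>
    define d where "d = e / (2 * measure lebesgue Q * b)"
    have d: "0 < d" using e b pos by (simp add: d_def)
    then have "lux_norm \<Phi> f Q < ennreal d" using 0 by simp
    then obtain a where a: "0 < a"
      "(\<integral>\<^sup>+ x. indicator Q x * ennreal (\<Phi> (\<bar>f x\<bar> / a)) \<partial>lebesgue) \<le> ?q" "ennreal a < ennreal d"
      unfolding lux_norm_eq_Inf[OF pos] Inf_less_iff by blast
    have "I \<le> 2 * ?q * (ennreal a * ennreal b)"
      unfolding I_def
      by (rule nn_integral_mult_le_modulars[OF \<Phi> \<Psi> young _ f _ a(1,2) b modb]) auto
    also have "\<dots> \<le> 2 * ?q * (ennreal d * ennreal b)"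
      using a by (intro mult_left_mono mult_right_mono) auto
    also have "2 * ?q * (ennreal d * ennreal b) = ennreal (2 * measure lebesgue Q * (d * b))"
      using b d pos by (simp add: ennreal_mult)
    also have "2 * measure lebesgue Q * (d * b) = e" using b pos by (simp add: d_def)
    finally show ?thesis .
  qed
  have "I = 0"
  proof (rule ccontr)
    assume "I \<noteq> 0"
    then have "0 < I" by (simp add: zero_less_iff_neq_zero)
    then obtain e where e: "0 < e" "e < I" using dense by blast
    then obtain r where r: "e = ennreal r" "0 \<le> r" by (cases e) auto
    with e le[of r] show False by (auto simp: not_le[symmetric])
  qed
  then have "AE x in lebesgue. indicator Q x * ennreal \<bar>f x * 1\<bar> = 0"
    unfolding I_def by (subst (asm) nn_integral_0_iff_AE) auto
  then show ?thesis by eventually_elim (auto split: split_indicator_asm)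
qed

text \<open>Each pair of admissible levels for \<open>f\<close> and \<open>g\<close> gives the bound
  with their product in place of the norms; then the infimum is taken over both levels.\<close>

lemma lux_norm_Hoelder:
  fixes f g :: "'a::euclidean_space \<Rightarrow> real"
  assumes \<Phi>: "orlicz_fun \<Phi>" and \<Psi>: "orlicz_fun \<Psi>"
    and young: "\<And>a b. 0 \<le> a \<Longrightarrow> 0 \<le> b \<Longrightarrow> a * b \<le> \<Phi> a + \<Psi> b"
    and Q: "Q \<in> lmeasurable" and pos: "0 < measure lebesgue Q"
    and f: "f \<in> borel_measurable lebesgue" and g: "g \<in> borel_measurable lebesgue"
  shows "(\<integral>\<^sup>+x. indicator Q x * ennreal \<bar>f x * g x\<bar> \<partial>lebesgue)
    \<le> 2 * ennreal (measure lebesgue Q) * (lux_norm \<Phi> f Q * lux_norm \<Psi> g Q)"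
proof -
  let ?q = "ennreal (measure lebesgue Q)"
  define I where "I = (\<integral>\<^sup>+x. indicator Q x * ennreal \<bar>f x * g x\<bar> \<partial>lebesgue)"
  define X where "X = I / (2 * ?q)"
  have q2: "0 < 2 * ?q" "2 * ?q < top"
    using pos by (auto simp: ennreal_zero_less_mult_iff ennreal_mult_less_top)
  have AE_imp: "X = 0" if "AE x in lebesgue. x \<in> Q \<longrightarrow> f x * g x = 0"
  proof -
    have "I = (\<integral>\<^sup>+x. 0 \<partial>(lebesgue :: 'a measure))"
      unfolding I_def using that by (intro nn_integral_cong_AE) (auto split: split_indicator)
    then show ?thesis by (simp add: X_def)
  qed
  have 1: "X = 0" if "lux_norm \<Phi> f Q = 0"
    using lux_norm_eq_0_imp_AE[OF \<Phi> \<Psi> young Q pos f that] by (intro AE_imp) auto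
  \<comment> \<open>The hypotheses are symmetric, so the vanishing lemma also applies to
    \<open>g\<close> with the two functions exchanged.\<close>
  have young': "a * b \<le> \<Psi> a + \<Phi> b" if "0 \<le> a" "0 \<le> b" for a b
    using young[OF that(2,1)] by (simp add: mult.commute add.commute)
  have 2: "X = 0" if "lux_norm \<Psi> g Q = 0"
    using lux_norm_eq_0_imp_AE[OF \<Psi> \<Phi> young' Q pos g that] by (intro AE_imp) auto
  define S where "S = {lam. 0 < lam \<and>
    (\<integral>\<^sup>+ x. indicator Q x * ennreal (\<Phi> (\<bar>f x\<bar> / lam)) \<partial>lebesgue) \<le> ?q}"
  define T where "T = {lam. 0 < lam \<and>
    (\<integral>\<^sup>+ x. indicator Q x * ennreal (\<Psi> (\<bar>g x\<bar> / lam)) \<partial>lebesgue) \<le> ?q}"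
  have norm_eq: "lux_norm \<Phi> f Q = Inf (ennreal ` S)" "lux_norm \<Psi> g Q = Inf (ennreal ` T)"
    unfolding S_def T_def by (rule lux_norm_eq_Inf[OF pos])+
  have "X \<le> Inf (ennreal ` S) * Inf (ennreal ` T)"
  proof (rule le_Inf_mult_ennreal)
    fix a b assume "a \<in> ennreal ` S" "b \<in> ennreal ` T"
    then obtain a' b' where ab: "a = ennreal a'" "b = ennreal b'" "a' \<in> S" "b' \<in> T" by blast
    have "I \<le> 2 * ?q * (ennreal a' * ennreal b')"
      unfolding I_def
      by (rule nn_integral_mult_le_modulars[OF \<Phi> \<Psi> young fmeasurableD[OF Q] f g])
        (use ab in \<open>auto simp: S_def T_def\<close>)
    then show "X \<le> a * b" unfolding X_def ab using q2 by (intro divide_le_posI_ennreal)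
  qed (use 1 2 norm_eq in \<open>auto simp: S_def T_def\<close>)
  then have "X \<le> lux_norm \<Phi> f Q * lux_norm \<Psi> g Q" by (simp add: norm_eq)
  then have "2 * ?q * X \<le> 2 * ?q * (lux_norm \<Phi> f Q * lux_norm \<Psi> g Q)"
    by (rule mult_left_mono) simp
  then show ?thesis
    unfolding X_def ennreal_mult_divide_cancel[OF q2] by (simp add: I_def)
qed

section \<open>Dyadic cubes\<close>

lemma sigma_finite_lebesgue: "sigma_finite_measure (lebesgue :: 'a::euclidean_space measure)"
proof
  obtain A :: "'a set set" where A: "countable A" "A \<subseteq> sets lborel" "\<Union>A = space lborel"
    "\<forall>a\<in>A. emeasure lborel a \<noteq> \<infinity>"
    using lborel.sigma_finite_countable by blast
  show "\<exists>A::'a set set. countable A \<and> A \<subseteq> sets lebesgue \<and> \<Union>A = space lebesgue \<and>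
      (\<forall>a\<in>A. emeasure lebesgue a \<noteq> \<infinity>)"
  proof (intro exI[of _ A] conjI ballI)
    show "A \<subseteq> sets lebesgue" using A(2) by blast
    show "\<Union>A = space lebesgue" using A(3) by simp
    show "emeasure lebesgue a \<noteq> \<infinity>" if "a \<in> A" for a using A(2,4) that by auto
  qed (rule A)
qed

text \<open>Cut off to growing balls, \<open>g\<close> becomes integrable, hence measurable, and the
  cut-offs eventually agree with \<open>g\<close> at each point.\<close>

lemma loc_integrable_imp_measurable:
  fixes g :: "'a::euclidean_space \<Rightarrow> real"
  assumes "loc_integrable g"
  shows "g \<in> borel_measurable lebesgue"
proof (rule borel_measurable_LIMSEQ_real)
  show "(\<lambda>x. indicator (cball 0 (real n)) x * g x) \<in> borel_measurable lebesgue" for n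
  proof -
    have "set_integrable lebesgue (cball 0 (real n)) g"
      using assms by (simp add: loc_integrable_def)
    then show ?thesis
      unfolding set_integrable_def real_scaleR_def by (rule borel_measurable_integrable)
  qed
  show "(\<lambda>n. indicator (cball 0 (real n)) x * g x) \<longlonglongrightarrow> g x" for x
  proof (rule tendsto_eventually)
    obtain N where "norm x \<le> real N" using real_arch_simple by blast
    then show "\<forall>\<^sub>F n in sequentially. indicator (cball 0 (real n)) x * g x = g x"
      by (intro eventually_sequentiallyI[of N]) (auto simp: indicator_def)
  qed
qed

section \<open>Geometry of dyadic cubes\<close>

lemma dyadic_cube_eq:
  "dyadic_cube Q \<longleftrightarrow> (\<exists>(k::int) (j::'a::euclidean_space \<Rightarrow> int).
     Q = {x. \<forall>i\<in>Basis. \<lfloor>2 powr k * (x \<bullet> i)\<rfloor> = j i})"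
proof -
  \<comment> \<open>The half-open bounds fix the integer part of each rescaled coordinate. In this
    form different scales can be compared by integer division.\<close>
  have "{x::'a. \<forall>i\<in>Basis. real_of_int (j i) / 2 powr k \<le> x \<bullet> i \<and> x \<bullet> i < real_of_int (j i + 1) / 2 powr k}
      = {x. \<forall>i\<in>Basis. \<lfloor>2 powr k * (x \<bullet> i)\<rfloor> = j i}" for k :: int and j :: "'a \<Rightarrow> int"
    by (intro Collect_cong ball_cong) (auto simp: floor_eq_iff field_simps)
  then show ?thesis by (simp add: dyadic_cube_def)
qed

lemma countable_dyadic_cubes: "countable {Q :: 'a::euclidean_space set. dyadic_cube Q}"
proof -
  let ?c = "\<lambda>(k::int, j). {x::'a. \<forall>i\<in>Basis. \<lfloor>2 powr k * (x \<bullet> i)\<rfloor> = j i}"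
  have "{Q :: 'a set. dyadic_cube Q} \<subseteq> ?c ` (UNIV \<times> (Basis \<rightarrow>\<^sub>E UNIV))"
  proof safe
    fix Q :: "'a set" assume "dyadic_cube Q"
    then obtain k :: int and j :: "'a \<Rightarrow> int" where "Q = ?c (k, j)"
      unfolding dyadic_cube_eq prod.case by blast
    \<comment> \<open>Only the values of \<open>j\<close> on the finite set \<open>Basis\<close>
      matter; all functions \<open>j\<close> together would form an uncountable index set.\<close>
    also have "\<dots> = ?c (k, restrict j Basis)" by simp
    finally have "Q = ?c (k, restrict j Basis)" .
    moreover have "restrict j Basis \<in> Basis \<rightarrow>\<^sub>E UNIV" by simp
    ultimately show "Q \<in> ?c ` (UNIV \<times> (Basis \<rightarrow>\<^sub>E UNIV))" by blast
  qed
  moreover have "countable (UNIV \<times> (Basis \<rightarrow>\<^sub>E UNIV) :: (int \<times> ('a \<Rightarrow> int)) set)"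
    by (intro countable_SIGMA countable_PiE) auto
  ultimately show ?thesis by (rule countable_subset[OF _ countable_image])
qed

text \<open>The index at a coarse scale is determined by the index at any finer scale, so a finer
  cube that meets a coarser one lies inside it.\<close>

lemma dyadic_cube_nested:
  fixes P Q :: "'a::euclidean_space set"
  assumes "dyadic_cube P" "dyadic_cube Q"
  shows "P \<subseteq> Q \<or> Q \<subseteq> P \<or> P \<inter> Q = {}"
proof -
  let ?c = "\<lambda>(k::int) j. {x::'a. \<forall>i\<in>Basis. \<lfloor>2 powr k * (x \<bullet> i)\<rfloor> = j i}"
  have sub: "?c k' j' \<subseteq> ?c k j" if "k \<le> k'" and z: "z \<in> ?c k j \<inter> ?c k' j'"
    for k k' :: int and j j' z
  proof
    fix x assume x: "x \<in> ?c k' j'"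
    define N :: int where "N = 2 ^ nat (k' - k)"
    have N: "2 powr k = 2 powr k' / real_of_int N"
      using \<open>k \<le> k'\<close> by (simp add: N_def powr_realpow[symmetric] powr_diff)
    \<comment> \<open>Dividing the fine index by \<open>N\<close>, the ratio of the side lengths,
      gives the coarse index.\<close>
    have *: "\<lfloor>2 powr k * t\<rfloor> = \<lfloor>2 powr k' * t\<rfloor> div N" for t :: real
      using floor_divide_real_eq_div[of N "2 powr k' * t"] by (simp add: N) (simp add: N_def)
    show "x \<in> ?c k j"
    proof safe
      fix i :: 'a assume i: "i \<in> Basis"
      then have "\<lfloor>2 powr k' * (x \<bullet> i)\<rfloor> = \<lfloor>2 powr k' * (z \<bullet> i)\<rfloor>" using x z by simp
      then have "\<lfloor>2 powr k * (x \<bullet> i)\<rfloor> = \<lfloor>2 powr k * (z \<bullet> i)\<rfloor>" by (simp add: *)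
      then show "\<lfloor>2 powr k * (x \<bullet> i)\<rfloor> = j i" using z i by simp
    qed
  qed
  obtain k j k' j' where PQ: "P = ?c k j" "Q = ?c k' j'"
    using assms unfolding dyadic_cube_eq by blast
  show ?thesis
  proof (cases "P \<inter> Q = {}")
    case False
    then obtain z where "z \<in> ?c k j \<inter> ?c k' j'" unfolding PQ by auto
    then show ?thesis using sub[of k k' z j j'] sub[of k' k z j' j] unfolding PQ
      using linear[of k k'] by blast
  qed simp
qed

lemma dyadic_cube_lmeasurable:
  fixes Q :: "'a::euclidean_space set"
  assumes "dyadic_cube Q"
  shows "Q \<in> lmeasurable" and "0 < measure lebesgue Q"
proof -
  obtain k :: int and j :: "'a \<Rightarrow> int" where Q: "Q = {x. \<forall>i\<in>Basis. real_of_int (j i) / 2 powr k \<le> x \<bullet> i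
      \<and> x \<bullet> i < real_of_int (j i + 1) / 2 powr k}"
    using assms unfolding dyadic_cube_def by blast
  define a b :: 'a where "a = (\<Sum>i\<in>Basis. (real_of_int (j i) / 2 powr k) *\<^sub>R i)"
    and "b = (\<Sum>i\<in>Basis. (real_of_int (j i + 1) / 2 powr k) *\<^sub>R i)"
  have ab: "a \<bullet> i < b \<bullet> i" if "i \<in> Basis" for i
    using that by (simp add: a_def b_def divide_strict_right_mono)
  \<comment> \<open>The open box inside gives positive measure, the closed box outside finite
    measure.\<close>
  have sub: "box a b \<subseteq> Q" "Q \<subseteq> cbox a b"
    by (auto simp: Q a_def b_def box_def cbox_def less_imp_le)
  have meas: "Q \<in> sets borel" unfolding Q by measurable
  show lm: "Q \<in> lmeasurable"
    by (rule fmeasurableI2[OF _ sub(2)]) (use meas in auto)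
  have "0 < measure lebesgue (box a b)"
    using ab by (auto simp: measure_lborel_box_eq less_imp_le inner_diff_left intro!: prod_pos)
  also have "\<dots> \<le> measure lebesgue Q"
    by (rule measure_mono_fmeasurable[OF sub(1) _ lm]) simp
  finally show "0 < measure lebesgue Q" .
qed

text \<open>The maximal members of a finite nested family are pairwise disjoint and cover its union,
  so the inequality can be added up over them.\<close>

lemma emeasure_nested_Union_le_finite:
  assumes fin: "finite F" and F: "F \<subseteq> sets M" and sets: "sets N = sets M"
    and nested: "\<And>P Q. P \<in> F \<Longrightarrow> Q \<in> F \<Longrightarrow> P \<subseteq> Q \<or> Q \<subseteq> P \<or> P \<inter> Q = {}"
    and le: "\<And>Q. Q \<in> F \<Longrightarrow> emeasure M Q \<le> emeasure N Q"
  shows "emeasure M (\<Union>F) \<le> emeasure N (\<Union>F)"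
proof -
  define G where "G = {Q \<in> F. \<forall>P\<in>F. Q \<subseteq> P \<longrightarrow> Q = P}"
  have G: "finite G" "G \<subseteq> F" using fin by (auto simp: G_def)
  have "\<exists>P\<in>G. Q \<subseteq> P" if Q: "Q \<in> F" for Q
  proof -
    obtain P where P: "P \<in> F" "Q \<subseteq> P" "\<And>R. R \<in> F \<Longrightarrow> P \<subseteq> R \<Longrightarrow> P = R"
      using finite_has_maximal2[OF fin Q] by auto
    then show ?thesis by (auto simp: G_def)
  qed
  then have U: "\<Union>F = \<Union>G" using G by blast
  have disj: "disjoint_family_on (\<lambda>Q. Q) G"
    unfolding disjoint_family_on_def
  proof (intro ballI impI)
    fix P Q assume "P \<in> G" "Q \<in> G" "P \<noteq> Q"
    then show "P \<inter> Q = {}" using nested[of P Q] unfolding G_def by blast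
  qed
  have "emeasure M (\<Union>F) = (\<Sum>Q\<in>G. emeasure M Q)"
    unfolding U using sum_emeasure[of "\<lambda>Q. Q" G M] disj G F by auto
  also have "\<dots> \<le> (\<Sum>Q\<in>G. emeasure N Q)" using G by (intro sum_mono le) auto
  also have "\<dots> = emeasure N (\<Union>F)"
    unfolding U using sum_emeasure[of "\<lambda>Q. Q" G N] disj G F sets by auto
  finally show ?thesis .
qed

text \<open>An infinite family may contain ascending chains without maximal members. It is therefore
  exhausted by finite subfamilies, using continuity of the measure from below.\<close>

lemma emeasure_nested_Union_le:
  assumes count: "countable F" and F: "F \<subseteq> sets M" and sets: "sets N = sets M"
    and nested: "\<And>P Q. P \<in> F \<Longrightarrow> Q \<in> F \<Longrightarrow> P \<subseteq> Q \<or> Q \<subseteq> P \<or> P \<inter> Q = {}"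
    and le: "\<And>Q. Q \<in> F \<Longrightarrow> emeasure M Q \<le> emeasure N Q"
  shows "emeasure M (\<Union>F) \<le> emeasure N (\<Union>F)"
proof (cases "F = {}")
  case False
  define A where "A n = from_nat_into F ` {..n::nat}" for n
  have A: "finite (A n)" "A n \<subseteq> F" for n
    using from_nat_into[OF False] unfolding A_def by auto
  have U: "(\<Union>n. \<Union>(A n)) = \<Union>F"
  proof -
    have "(\<Union>n. A n) = from_nat_into F ` UNIV" unfolding A_def by blast
    also have "\<dots> = F" using range_from_nat_into[OF False count] .
    finally show ?thesis by blast
  qed
  have meas: "\<Union>(A n) \<in> sets M" for n
    using A[of n] F by (intro sets.finite_Union) auto
  have inc: "incseq (\<lambda>n. \<Union>(A n))"
    unfolding incseq_def A_def by (intro allI impI Union_mono image_mono) auto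
  have "emeasure M (\<Union>F) = (SUP n. emeasure M (\<Union>(A n)))"
    unfolding U[symmetric] using meas inc by (intro SUP_emeasure_incseq[symmetric]) auto
  also have "\<dots> \<le> emeasure N (\<Union>F)"
  proof (rule SUP_least)
    fix n
    have "emeasure M (\<Union>(A n)) \<le> emeasure N (\<Union>(A n))"
    proof (rule emeasure_nested_Union_le_finite[OF A(1) _ sets])
      show "A n \<subseteq> sets M" using A(2) F by blast
      show "P \<subseteq> Q \<or> Q \<subseteq> P \<or> P \<inter> Q = {}" if "P \<in> A n" "Q \<in> A n" for P Q
        using nested A(2) that by blast
      show "emeasure M Q \<le> emeasure N Q" if "Q \<in> A n" for Q using le A(2) that by blast
    qed
    also have "\<dots> \<le> emeasure N (\<Union>F)"
      using A(2)[of n] F by (intro emeasure_mono Union_mono) (simp_all add: sets sets.countable_Union[OF count])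
    finally show "emeasure M (\<Union>(A n)) \<le> emeasure N (\<Union>F)" .
  qed
  finally show ?thesis .
qed simp

section \<open>A Carleson embedding for Luxemburg norms\<close>

text \<open>With \<open>\<lambda> = 1 / t\<close> this is \<open>a^s\<close> as the integral of
  \<open>s \<lambda>^(s-1)\<close> over \<open>0 < \<lambda> < a\<close>. The reciprocal parameter
  turns the modular at level \<open>\<lambda>\<close> into one of \<open>|h| * t\<close>.\<close>

lemma epow_layer_cake:
  assumes s: "0 < s"
  shows "epow a s \<le> (\<integral>\<^sup>+t. ennreal (s * t powr (- s - 1)) * indicator {t. 0 < t \<and> ennreal (1 / t) < a} t \<partial>lborel)"
    (is "_ \<le> ?R")
  unfolding epow_le_iff[OF s]
proof (rule dense_le)
  fix y assume y: "y < a"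
  then have "y < top" by (metis order_less_le_trans top_greatest)
  then obtain b where b: "y = ennreal b" "0 \<le> b" by (cases y) auto
  show "y \<le> epow ?R (1 / s)"
    unfolding epow_le_iff[OF s, symmetric]
  proof (cases "b = 0")
    case False
    with b have b0: "0 < b" by simp
    \<comment> \<open>The antiderivative of the kernel vanishes at infinity, so the lower limit
      \<open>1 / b\<close> alone contributes, namely \<open>b^s\<close>.\<close>
    have "((\<lambda>t::real. - (t powr - s)) \<longlongrightarrow> - 0) at_top"
      by (intro tendsto_minus tendsto_neg_powr filterlim_ident) (use s in simp)
    then have lim: "((\<lambda>t::real. - (t powr - s)) \<longlongrightarrow> 0) at_top" by simp
    have "(\<integral>\<^sup>+t. ennreal (s * t powr (- s - 1)) * indicator {1 / b..} t \<partial>lborel)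
        = ennreal (0 - - ((1 / b) powr - s))"
    proof (rule nn_integral_FTC_atLeast[OF _ _ _ lim])
      fix t assume "1 / b \<le> t"
      then have t: "0 < t" using b0 by (meson less_le_trans zero_less_divide_1_iff)
      show "((\<lambda>t. - (t powr - s)) has_real_derivative s * t powr (- s - 1)) (at t)"
        using t by (auto intro!: derivative_eq_intros)
      show "0 \<le> s * t powr (- s - 1)" using s by simp
    qed measurable
    also have "0 - - ((1 / b) powr - s) = b powr s"
      using b0 by (simp add: powr_minus powr_divide)
    also have "ennreal (b powr s) = epow y s" using b by (simp add: epow_ennreal)
    finally have eq: "epow y s = (\<integral>\<^sup>+t. ennreal (s * t powr (- s - 1)) * indicator {1 / b..} t \<partial>lborel)" ..
    show "epow y s \<le> ?R"
      unfolding eq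
    proof (intro nn_integral_mono mult_left_mono)
      fix t :: real
      have "0 < t \<and> ennreal (1 / t) < a" if "1 / b \<le> t"
      proof
        show t: "0 < t" using that b0 by (meson less_le_trans zero_less_divide_1_iff)
        have "1 / t \<le> b" using that t b0 by (simp add: field_simps)
        then have "ennreal (1 / t) \<le> y" unfolding b by (rule ennreal_leI)
        then show "ennreal (1 / t) < a" using y by simp
      qed
      then show "indicator {1 / b..} t \<le> (indicator {t. 0 < t \<and> ennreal (1 / t) < a} t :: ennreal)"
        by (auto split: split_indicator)
    qed simp
  qed (simp add: b)
qed

text \<open>For \<open>r = s / p\<close> this is \<open>s\<close> times the integral in
  \<open>B_cond p s \<Phi>\<close>, started at \<open>c\<close> instead of 1. The absolute value
  keeps the argument of \<open>\<Phi>\<close> where it is monotone, which gives measurability on the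
  whole line.\<close>

definition orlicz_tail :: "real \<Rightarrow> real \<Rightarrow> real \<Rightarrow> (real \<Rightarrow> real) \<Rightarrow> ennreal" where
  "orlicz_tail r s c \<Phi> = (\<integral>\<^sup>+t. ennreal (s * t powr (- s - 1) * \<Phi> \<bar>t\<bar> powr r) * indicator {c<..} t \<partial>lborel)"

text \<open>In the tail integral \<open>t\<close> is replaced by \<open>y * t\<close>: the Jacobian
  \<open>y\<close> and the factor \<open>y powr (- s - 1)\<close> of the kernel cancel against
  \<open>y powr s\<close>. For \<open>y = 0\<close> both sides vanish because
  \<open>c > 0\<close>.\<close>

lemma orlicz_tail_scale:
  assumes \<Phi>: "orlicz_fun \<Phi>" and c: "0 < c" and s: "0 < s" and y: "0 \<le> y"
  shows "(\<integral>\<^sup>+t. ennreal (s * t powr (- s - 1) * \<Phi> \<bar>y * t\<bar> powr r) * indicator {t. 0 < t \<and> c < y * t} t \<partial>lborel)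
    = ennreal (y powr s) * orlicz_tail r s c \<Phi>"
proof (cases "y = 0")
  case True
  have "indicator {t. 0 < t \<and> c < y * t} t = (0 :: ennreal)" for t using True c by simp
  then show ?thesis using True by simp
next
  case False
  with y have y: "0 < y" by simp
  have [measurable]: "(\<lambda>t::real. \<Phi> \<bar>t\<bar>) \<in> borel_measurable borel"
    by (rule borel_measurable_orlicz_fun[OF \<Phi>]) auto
  have "orlicz_tail r s c \<Phi> = ennreal \<bar>y\<bar> * (\<integral>\<^sup>+t. ennreal (s * (0 + y * t) powr (- s - 1) * \<Phi> \<bar>0 + y * t\<bar> powr r)
      * indicator {c<..} (0 + y * t) \<partial>lborel)"
    unfolding orlicz_tail_def using y
    by (subst nn_integral_real_affine[of _ y 0]) auto
  also have "\<dots> = (\<integral>\<^sup>+t. ennreal y * (ennreal (s * (y * t) powr (- s - 1) * \<Phi> \<bar>y * t\<bar> powr r)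
      * indicator {c<..} (y * t)) \<partial>lborel)"
    using y by (subst nn_integral_cmult) auto
  finally have "ennreal (y powr s) * orlicz_tail r s c \<Phi>
    = (\<integral>\<^sup>+t. ennreal (y powr s) * (ennreal y * (ennreal (s * (y * t) powr (- s - 1) * \<Phi> \<bar>y * t\<bar> powr r)
      * indicator {c<..} (y * t))) \<partial>lborel)"
    by (subst nn_integral_cmult) auto
  also have "\<dots> = (\<integral>\<^sup>+t. ennreal (s * t powr (- s - 1) * \<Phi> \<bar>y * t\<bar> powr r) * indicator {t. 0 < t \<and> c < y * t} t \<partial>lborel)"
  proof (rule nn_integral_cong)
    fix t :: real
    show "ennreal (y powr s) * (ennreal y * (ennreal (s * (y * t) powr (- s - 1) * \<Phi> \<bar>y * t\<bar> powr r)
      * indicator {c<..} (y * t)))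
      = ennreal (s * t powr (- s - 1) * \<Phi> \<bar>y * t\<bar> powr r) * indicator {t. 0 < t \<and> c < y * t} t"
    proof (cases "c < y * t")
      case True
      then have t: "0 < t" using c y by (metis less_trans zero_less_mult_pos)
      have "y powr s * (y * (y powr (- s - 1))) = 1"
        using y by (simp add: powr_mult_base powr_add[symmetric])
      then have "y powr s * (y * (s * (y * t) powr (- s - 1) * \<Phi> \<bar>y * t\<bar> powr r))
        = s * t powr (- s - 1) * \<Phi> \<bar>y * t\<bar> powr r"
        using y t by (simp add: powr_mult algebra_simps)
      then show ?thesis
        using True t y s by (simp add: ennreal_mult[symmetric])
    qed simp
  qed
  finally show ?thesis ..
qed

text \<open>Beyond 1 the integrand is \<open>s\<close> times that of \<open>B_cond\<close>. Between
  \<open>c\<close> and 1 it is bounded, because \<open>c > 0\<close> keeps \<open>t\<close> away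
  from the singularity of the kernel at 0.\<close>

lemma orlicz_tail_finite:
  assumes \<Phi>: "orlicz_fun \<Phi>" and c: "0 < c" and p: "0 < p" "0 < s" and B: "B_cond p s \<Phi>"
  shows "orlicz_tail (s / p) s c \<Phi> < top"
proof -
  let ?r = "s / p"
  have [measurable]: "(\<lambda>t::real. \<Phi> \<bar>t\<bar>) \<in> borel_measurable borel"
    by (rule borel_measurable_orlicz_fun[OF \<Phi>]) auto
  let ?K = "s * c powr (- s - 1) * \<Phi> 1 powr ?r"
  have "orlicz_tail ?r s c \<Phi> \<le> (\<integral>\<^sup>+t. ennreal ?K * indicator {c..1} t
      + ennreal s * (indicator {1..} t * ennreal (\<Phi> \<bar>t\<bar> powr ?r / t powr s / t)) \<partial>lborel)"
    unfolding orlicz_tail_def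
  proof (rule nn_integral_mono)
    fix t :: real
    show "ennreal (s * t powr (- s - 1) * \<Phi> \<bar>t\<bar> powr ?r) * indicator {c<..} t
      \<le> ennreal ?K * indicator {c..1} t
      + ennreal s * (indicator {1..} t * ennreal (\<Phi> \<bar>t\<bar> powr ?r / t powr s / t))"
    proof (cases "t \<le> 1")
      case True
      show ?thesis
      proof (cases "c < t")
        case c': True
        have "s * t powr (- s - 1) * \<Phi> \<bar>t\<bar> powr ?r \<le> ?K"
          using p c c' True
          by (intro mult_mono powr_mono2 powr_mono2' orlicz_fun_mono[OF \<Phi>] orlicz_fun_nonneg[OF \<Phi>])
             auto
        then have "ennreal (s * t powr (- s - 1) * \<Phi> \<bar>t\<bar> powr ?r) \<le> ennreal ?K" by (rule ennreal_leI)
        then show ?thesis using c' True by (simp add: add_increasing2)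
      qed simp
    next
      case False
      then have eq: "s * t powr (- s - 1) * \<Phi> \<bar>t\<bar> powr ?r = s * (\<Phi> \<bar>t\<bar> powr ?r / t powr s / t)"
        using powr_add[of t "-s" "-1"] by (simp add: powr_minus divide_simps)
      have i: "indicator {1..} t = (1 :: ennreal)" using False by simp
      have "ennreal (s * t powr (- s - 1) * \<Phi> \<bar>t\<bar> powr ?r) * indicator {c<..} t
          \<le> ennreal (s * t powr (- s - 1) * \<Phi> \<bar>t\<bar> powr ?r)"
        by (simp split: split_indicator)
      also have "\<dots> = ennreal s * (indicator {1..} t * ennreal (\<Phi> \<bar>t\<bar> powr ?r / t powr s / t))"
        unfolding eq i using p by (subst ennreal_mult') auto
      finally show ?thesis by (rule order_trans) simp
    qed
  qed
  also have "\<dots> = ennreal ?K * emeasure lborel {c..1}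
      + ennreal s * (\<integral>\<^sup>+t. indicator {1..} t * ennreal (\<Phi> \<bar>t\<bar> powr ?r / t powr s / t) \<partial>lborel)"
    by (simp add: nn_integral_add nn_integral_cmult nn_integral_cmult_indicator)
  also have "(\<integral>\<^sup>+t. indicator {1..} t * ennreal (\<Phi> \<bar>t\<bar> powr ?r / t powr s / t) \<partial>lborel)
    = (\<integral>\<^sup>+t. indicator {1..} t * ennreal (\<Phi> t powr ?r / t powr s / t) \<partial>lborel)"
    by (intro nn_integral_cong) (auto split: split_indicator)
  also have "ennreal ?K * emeasure lborel {c..1} + ennreal s * \<dots> < top"
    using B by (auto simp: B_cond_def ennreal_mult_less_top emeasure_lborel_cbox_eq[of c 1, unfolded cbox_interval])
  finally show ?thesis .
qed

text \<open>Where \<open>\<bar>h\<bar> t \<le> c\<close> the integrand \<open>\<Phi> (\<bar>h\<bar> t)\<close> is at most \<open>1/2\<close>, so that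
  part of the integral can be absorbed into the left-hand side.\<close>
lemma measure_le_of_lux_norm_gt:
  fixes h :: "'a::euclidean_space \<Rightarrow> real"
  assumes \<Phi>: "orlicz_fun \<Phi>" and c: "0 < c" "\<Phi> c \<le> 1 / 2" and t: "0 < t"
    and Q: "Q \<in> lmeasurable" and pos: "0 < measure lebesgue Q"
    and h [measurable]: "h \<in> borel_measurable lebesgue"
    and gt: "ennreal (1 / t) < lux_norm \<Phi> h Q"
  shows "emeasure lebesgue Q
    \<le> (\<integral>\<^sup>+x. 2 * (ennreal (\<Phi> \<bar>\<bar>h x\<bar> * t\<bar>) * indicator {x. c < \<bar>h x\<bar> * t} x) * indicator Q x \<partial>lebesgue)"
proof -
  let ?q = "measure lebesgue Q"
  have [measurable]: "Q \<in> sets lebesgue" using Q by (rule fmeasurableD)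
  have [measurable]: "(\<lambda>x. \<Phi> \<bar>\<bar>h x\<bar> * t\<bar>) \<in> borel_measurable lebesgue"
    by (rule borel_measurable_orlicz_fun[OF \<Phi>]) auto
  define V where "V = (\<integral>\<^sup>+x. ennreal (\<Phi> \<bar>\<bar>h x\<bar> * t\<bar>) * indicator {x. c < \<bar>h x\<bar> * t} x * indicator Q x \<partial>lebesgue)"
  have eq: "\<bar>h x\<bar> / (1 / t) = \<bar>\<bar>h x\<bar> * t\<bar>" for x using t by (simp add: abs_mult)
  \<comment> \<open>Otherwise \<open>1 / t\<close> would be an admissible level and the norm could
    not exceed it.\<close>
  have "ennreal ?q < (\<integral>\<^sup>+ x. indicator Q x * ennreal (\<Phi> (\<bar>h x\<bar> / (1 / t))) \<partial>lebesgue)"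
  proof (rule ccontr)
    assume "\<not> ?thesis"
    then have "lux_norm \<Phi> h Q \<le> ennreal (1 / t)"
      unfolding lux_norm_eq_Inf[OF pos] using t by (intro Inf_lower imageI) auto
    with gt show False by simp
  qed
  also have "\<dots> \<le> (\<integral>\<^sup>+ x. ennreal (1 / 2) * indicator Q x
      + ennreal (\<Phi> \<bar>\<bar>h x\<bar> * t\<bar>) * indicator {x. c < \<bar>h x\<bar> * t} x * indicator Q x \<partial>lebesgue)"
    unfolding eq
  proof (rule nn_integral_mono)
    fix x
    have "\<Phi> \<bar>\<bar>h x\<bar> * t\<bar> \<le> 1 / 2" if "\<not> c < \<bar>h x\<bar> * t"
    proof -
      have "\<Phi> \<bar>\<bar>h x\<bar> * t\<bar> \<le> \<Phi> c" using that t by (intro orlicz_fun_mono[OF \<Phi>]) auto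
      then show ?thesis using c by simp
    qed
    then have "ennreal (\<Phi> \<bar>\<bar>h x\<bar> * t\<bar>) \<le> ennreal (1 / 2)" if "\<not> c < \<bar>h x\<bar> * t"
      using that by (intro ennreal_leI) auto
    then show "indicator Q x * ennreal (\<Phi> \<bar>\<bar>h x\<bar> * t\<bar>) \<le> ennreal (1 / 2) * indicator Q x
      + ennreal (\<Phi> \<bar>\<bar>h x\<bar> * t\<bar>) * indicator {x. c < \<bar>h x\<bar> * t} x * indicator Q x"
      by (cases "x \<in> Q"; cases "c < \<bar>h x\<bar> * t") (auto simp: add_increasing)
  qed
  also have "\<dots> = ennreal (1 / 2) * emeasure lebesgue Q + V"
    unfolding V_def by (subst nn_integral_add) (auto simp: nn_integral_cmult_indicator simp del: ennreal_half)
  also have "emeasure lebesgue Q = ennreal ?q" using Q by (simp add: emeasure_eq_measure2)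
  finally have le: "ennreal ?q \<le> ennreal (1 / 2) * ennreal ?q + V" by simp
  \<comment> \<open>Subtracting \<open>|Q| / 2\<close> from both sides takes place among real
    numbers; for \<open>V = top\<close> the claim is trivial.\<close>
  have "ennreal ?q \<le> 2 * V"
  proof (cases V)
    case (real v)
    have eq1: "2 * V = ennreal (2 * v)" using real by (simp add: ennreal_mult)
    have eq2: "ennreal (1 / 2) * ennreal ?q + V = ennreal (1 / 2 * ?q + v)"
      using real by (simp add: ennreal_mult'[symmetric] del: ennreal_half)
    have "?q \<le> 1 / 2 * ?q + v"
      using le real unfolding eq2 by (subst (asm) ennreal_le_iff) auto
    then show ?thesis using eq1 real by simp
  qed (simp add: ennreal_mult_top)
  also have "2 * V = (\<integral>\<^sup>+x. 2 * (ennreal (\<Phi> \<bar>\<bar>h x\<bar> * t\<bar>) * indicator {x. c < \<bar>h x\<bar> * t} x * indicator Q x) \<partial>lebesgue)"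
    unfolding V_def by (subst nn_integral_cmult) auto
  finally show ?thesis using Q by (simp add: emeasure_eq_measure2 mult.assoc)
qed

text \<open>Let \<open>W\<close> be the integral on the right. Each selected cube has
  \<open>|Q| \<le> W\<close>, which controls \<open>|Q|^(r-1)\<close> since
  \<open>r \<ge> 1\<close>. Their union also has measure at most \<open>W\<close>, which controls
  the sum of the disjoint sets \<open>E Q\<close>. The product of the two bounds is
  \<open>W^r\<close>.\<close>

lemma sum_lux_norm_gt_le:
  fixes h :: "'a::euclidean_space \<Rightarrow> real"
  assumes \<Phi>: "orlicz_fun \<Phi>" and c: "0 < c" "\<Phi> c \<le> 1 / 2" and t: "0 < t" and r: "1 \<le> r"
    and S: "\<And>Q. Q \<in> S \<Longrightarrow> dyadic_cube Q"
    and E: "disjoint_family_on E S" "\<And>Q. Q \<in> S \<Longrightarrow> E Q \<subseteq> Q" "\<And>Q. Q \<in> S \<Longrightarrow> E Q \<in> sets lebesgue"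
    and h [measurable]: "h \<in> borel_measurable lebesgue"
  shows "(\<integral>\<^sup>+Q. emeasure lebesgue (E Q) * ennreal (measure lebesgue Q powr (r - 1))
      * indicator {Q. ennreal (1 / t) < lux_norm \<Phi> h Q} Q \<partial>count_space S)
    \<le> epow (\<integral>\<^sup>+x. 2 * (ennreal (\<Phi> \<bar>\<bar>h x\<bar> * t\<bar>) * indicator {x. c < \<bar>h x\<bar> * t} x) \<partial>lebesgue) r"
proof -
  let ?g = "\<lambda>x. 2 * (ennreal (\<Phi> \<bar>\<bar>h x\<bar> * t\<bar>) * indicator {x. c < \<bar>h x\<bar> * t} x)"
  have [measurable]: "(\<lambda>x. \<Phi> \<bar>\<bar>h x\<bar> * t\<bar>) \<in> borel_measurable lebesgue"
    by (rule borel_measurable_orlicz_fun[OF \<Phi>]) auto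
  define W where "W = (\<integral>\<^sup>+x. ?g x \<partial>lebesgue)"
  define F where "F = {Q \<in> S. ennreal (1 / t) < lux_norm \<Phi> h Q}"
  note lm = dyadic_cube_lmeasurable[OF S]
  have countS: "countable S"
    by (rule countable_subset[OF _ countable_dyadic_cubes]) (use S in auto)
  then have countF: "countable F" by (rule countable_subset[rotated]) (auto simp: F_def)
  have FS: "F \<subseteq> S" by (auto simp: F_def)
  have Fle: "emeasure lebesgue Q \<le> (\<integral>\<^sup>+x. ?g x * indicator Q x \<partial>lebesgue)" if "Q \<in> F" for Q
    using that lm by (intro measure_le_of_lux_norm_gt[OF \<Phi> c t]) (auto simp: F_def)
  have le_W: "(\<integral>\<^sup>+x. ?g x * indicator A x \<partial>lebesgue) \<le> W" for A
    unfolding W_def by (intro nn_integral_mono) (auto split: split_indicator)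
  have sets_F: "F \<subseteq> sets lebesgue" using FS lm(1) by (auto intro: fmeasurableD)
  \<comment> \<open>Reading the integral of \<open>?g\<close> as a measure with density
    \<open>?g\<close> makes this a comparison of two measures on a nested family.\<close>
  have "emeasure lebesgue (\<Union>F) \<le> emeasure (density lebesgue ?g) (\<Union>F)"
  proof (rule emeasure_nested_Union_le[OF countF sets_F])
    show "P \<subseteq> Q \<or> Q \<subseteq> P \<or> P \<inter> Q = {}" if "P \<in> F" "Q \<in> F" for P Q
      using that FS S by (intro dyadic_cube_nested) auto
    show "emeasure lebesgue Q \<le> emeasure (density lebesgue ?g) Q" if "Q \<in> F" for Q
      using Fle[OF that] sets_F that by (subst emeasure_density) auto
  qed simp
  also have "\<dots> \<le> W"
    using sets.countable_Union[OF countF sets_F] le_W by (subst emeasure_density) auto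
  finally have weak: "emeasure lebesgue (\<Union>F) \<le> W" .
  \<comment> \<open>Emptying \<open>E Q\<close> for the cubes outside \<open>F\<close> lets the sum
    still run over \<open>S\<close>.\<close>
  define E' where "E' Q = (if Q \<in> F then E Q else {})" for Q
  have "(\<integral>\<^sup>+Q. emeasure lebesgue (E' Q) \<partial>count_space S) = emeasure lebesgue (\<Union>(E' ` S))"
    using E by (intro emeasure_UN_countable[symmetric] countS)
      (auto simp: E'_def disjoint_family_on_def)
  also have "\<dots> \<le> emeasure lebesgue (\<Union>F)"
    using E FS by (intro emeasure_mono sets.countable_Union[OF countF sets_F])
      (auto simp: E'_def split: if_splits)
  finally have sum_E: "(\<integral>\<^sup>+Q. emeasure lebesgue (E' Q) \<partial>count_space S) \<le> W" using weak by simp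
  show ?thesis
    unfolding W_def[symmetric]
  proof (cases W)
    case (real w)
    have "(\<integral>\<^sup>+Q. emeasure lebesgue (E Q) * ennreal (measure lebesgue Q powr (r - 1))
        * indicator {Q. ennreal (1 / t) < lux_norm \<Phi> h Q} Q \<partial>count_space S)
      \<le> (\<integral>\<^sup>+Q. ennreal (w powr (r - 1)) * emeasure lebesgue (E' Q) \<partial>count_space S)"
    proof (rule nn_integral_mono)
      fix Q assume "Q \<in> space (count_space S)"
      then have QS: "Q \<in> S" by simp
      show "emeasure lebesgue (E Q) * ennreal (measure lebesgue Q powr (r - 1))
          * indicator {Q. ennreal (1 / t) < lux_norm \<Phi> h Q} Q
        \<le> ennreal (w powr (r - 1)) * emeasure lebesgue (E' Q)"
      proof (cases "Q \<in> F")
        case True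
        have "ennreal (measure lebesgue Q) \<le> ennreal w"
          using order_trans[OF Fle[OF True] le_W] lm(1)[OF QS] real
          by (simp add: emeasure_eq_measure2 del: ennreal_le_iff)
        then have "measure lebesgue Q powr (r - 1) \<le> w powr (r - 1)"
          using r real by (intro powr_mono2) auto
        then have "ennreal (measure lebesgue Q powr (r - 1)) \<le> ennreal (w powr (r - 1))"
          by (rule ennreal_leI)
        then show ?thesis using True
          by (auto simp: E'_def mult.commute split: split_indicator intro!: mult_left_mono)
      next
        case False
        then show ?thesis using QS by (auto simp: F_def)
      qed
    qed
    also have "\<dots> = ennreal (w powr (r - 1)) * (\<integral>\<^sup>+Q. emeasure lebesgue (E' Q) \<partial>count_space S)"
      by (rule nn_integral_cmult) simp
    also have "\<dots> \<le> ennreal (w powr (r - 1)) * W" using sum_E by (rule mult_left_mono) simp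
    also have "\<dots> = epow W r"
      using real powr_mult_base[of w "r - 1"]
      by (simp add: epow_ennreal ennreal_mult[symmetric] mult.commute)
    finally show "(\<integral>\<^sup>+Q. emeasure lebesgue (E Q) * ennreal (measure lebesgue Q powr (r - 1))
        * indicator {Q. ennreal (1 / t) < lux_norm \<Phi> h Q} Q \<partial>count_space S) \<le> epow W r" .
  qed simp
qed

text \<open>The constant is \<open>2 powr r\<close> times a tail integral, with
  \<open>r = s / p\<close>. It is fixed before \<open>S\<close>, \<open>E\<close> and
  \<open>h\<close>, so it depends on \<open>p\<close>, \<open>s\<close> and \<open>\<Phi>\<close>
  alone.\<close>

lemma orlicz_carleson_embedding:
  assumes \<Phi>: "orlicz_fun \<Phi>" and p: "0 < p" "p \<le> s" and B: "B_cond p s \<Phi>"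
  shows "\<exists>C\<ge>0. \<forall>(S :: 'a::euclidean_space set set) E h.
    (\<forall>Q\<in>S. dyadic_cube Q \<and> E Q \<subseteq> Q \<and> E Q \<in> sets lebesgue) \<longrightarrow> disjoint_family_on E S \<longrightarrow>
    h \<in> borel_measurable lebesgue \<longrightarrow>
    (\<integral>\<^sup>+Q. emeasure lebesgue (E Q) * ennreal (measure lebesgue Q powr (s / p - 1))
      * epow (lux_norm \<Phi> h Q) s \<partial>count_space S)
    \<le> ennreal C * epow (\<integral>\<^sup>+x. ennreal (\<bar>h x\<bar> powr p) \<partial>lebesgue) (s / p)"
proof -
  define r where "r = s / p"
  have s: "0 < s" and r: "1 \<le> r" "0 < r" and rp: "s * (1 / r) = p" using p by (auto simp: r_def)
  \<comment> \<open>Small enough that scaling yields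
    \<open>\<Phi> c \<le> c * \<Phi> 1 \<le> 1 / 2\<close>, as the absorption at each level
    requires, and positive, so that the tail integral is finite.\<close>
  define c where "c = 1 / (2 * (\<Phi> 1 + 1))"
  have \<Phi>1: "0 \<le> \<Phi> 1" by (simp add: orlicz_fun_nonneg[OF \<Phi>])
  then have c0: "0 < c" by (simp add: c_def)
  have "\<Phi> c \<le> c * \<Phi> 1" using orlicz_fun_scale[OF \<Phi>, of c 1] c0 \<Phi>1 by (simp add: c_def)
  also have "\<dots> \<le> 1 / 2" using \<Phi>1 by (simp add: c_def field_simps)
  finally have c1: "\<Phi> c \<le> 1 / 2" .
  define J where "J = enn2real (orlicz_tail r s c \<Phi>)"
  have J: "orlicz_tail r s c \<Phi> = ennreal J" "0 \<le> J"
    using orlicz_tail_finite[OF \<Phi> c0 p(1) s B] by (auto simp: J_def r_def less_top)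
  have \<Phi>_abs [measurable]: "(\<lambda>t::real. \<Phi> \<bar>t\<bar>) \<in> borel_measurable borel"
    by (rule borel_measurable_orlicz_fun[OF \<Phi>]) auto
  have "(\<integral>\<^sup>+Q. emeasure lebesgue (E Q) * ennreal (measure lebesgue Q powr (s / p - 1))
      * epow (lux_norm \<Phi> h Q) s \<partial>count_space S)
    \<le> ennreal (2 powr r * J) * epow (\<integral>\<^sup>+x. ennreal (\<bar>h x\<bar> powr p) \<partial>lebesgue) (s / p)"
    if S: "\<forall>Q\<in>S. dyadic_cube Q \<and> E Q \<subseteq> Q \<and> E Q \<in> sets lebesgue" and E: "disjoint_family_on E S"
      and h [measurable]: "h \<in> borel_measurable lebesgue"
    for S :: "'a set set" and E :: "'a set \<Rightarrow> 'a set" and h :: "'a \<Rightarrow> real"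
  proof -
    define k where "k t = s * t powr (- s - 1)" for t :: real
    have k: "0 \<le> k t" for t using s by (simp add: k_def)
    have [measurable]: "k \<in> borel_measurable borel" unfolding k_def by measurable
    define m where "m Q = emeasure lebesgue (E Q) * ennreal (measure lebesgue Q powr (r - 1))" for Q
    \<comment> \<open>The kernel enters with the power \<open>1 / r\<close>, so that it sits under
      the outer power \<open>r\<close> and Minkowski applies to the single function
      \<open>F\<close>.\<close>
    define F where "F x t = ennreal (k t powr (1 / r)) * indicator {0<..} t
      * (2 * (ennreal (\<Phi> \<bar>\<bar>h x\<bar> * t\<bar>) * indicator {x. c < \<bar>h x\<bar> * t} x))" for x :: 'a and t :: real
    have countS: "countable S"
      by (rule countable_subset[OF _ countable_dyadic_cubes]) (use S in auto)
    have "(\<integral>\<^sup>+Q. m Q * epow (lux_norm \<Phi> h Q) s \<partial>count_space S)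
      \<le> (\<integral>\<^sup>+Q. m Q * (\<integral>\<^sup>+t. ennreal (k t) * indicator {t. 0 < t \<and> ennreal (1 / t) < lux_norm \<Phi> h Q} t \<partial>lborel) \<partial>count_space S)"
      unfolding k_def by (intro nn_integral_mono mult_left_mono epow_layer_cake s) auto
    also have "\<dots> = (\<integral>\<^sup>+Q. (\<integral>\<^sup>+t. m Q * (ennreal (k t) * indicator {t. 0 < t \<and> ennreal (1 / t) < lux_norm \<Phi> h Q} t) \<partial>lborel) \<partial>count_space S)"
      by (intro nn_integral_cong nn_integral_cmult[symmetric]) measurable
    also have "\<dots> = (\<integral>\<^sup>+t. (\<integral>\<^sup>+Q. m Q * (ennreal (k t) * indicator {t. 0 < t \<and> ennreal (1 / t) < lux_norm \<Phi> h Q} t) \<partial>count_space S) \<partial>lborel)"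
      by (intro nn_integral_count_space_nn_integral[symmetric] countS) measurable
    also have "\<dots> \<le> (\<integral>\<^sup>+t. epow (\<integral>\<^sup>+x. F x t \<partial>lebesgue) r \<partial>lborel)"
    proof (rule nn_integral_mono)
      fix t :: real
      have [measurable]: "(\<lambda>x. \<Phi> \<bar>\<bar>h x\<bar> * t\<bar>) \<in> borel_measurable lebesgue"
        by (rule borel_measurable_orlicz_fun[OF \<Phi>]) auto
      have meas: "(\<lambda>x. 2 * (ennreal (\<Phi> \<bar>\<bar>h x\<bar> * t\<bar>) * indicator {x. c < \<bar>h x\<bar> * t} x)) \<in> borel_measurable lebesgue"
        by measurable
      show "(\<integral>\<^sup>+Q. m Q * (ennreal (k t) * indicator {t. 0 < t \<and> ennreal (1 / t) < lux_norm \<Phi> h Q} t) \<partial>count_space S)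
        \<le> epow (\<integral>\<^sup>+x. F x t \<partial>lebesgue) r"
      proof (cases "0 < t")
        case t: True
        have "(\<integral>\<^sup>+Q. m Q * (ennreal (k t) * indicator {t. 0 < t \<and> ennreal (1 / t) < lux_norm \<Phi> h Q} t) \<partial>count_space S)
          = (\<integral>\<^sup>+Q. ennreal (k t) * (m Q * indicator {Q. ennreal (1 / t) < lux_norm \<Phi> h Q} Q) \<partial>count_space S)"
          using t by (intro nn_integral_cong) (auto split: split_indicator simp: mult_ac)
        also have "\<dots> = ennreal (k t) * (\<integral>\<^sup>+Q. m Q * indicator {Q. ennreal (1 / t) < lux_norm \<Phi> h Q} Q \<partial>count_space S)"
          by (rule nn_integral_cmult) simp
        also have "\<dots> \<le> ennreal (k t) *
            epow (\<integral>\<^sup>+x. 2 * (ennreal (\<Phi> \<bar>\<bar>h x\<bar> * t\<bar>) * indicator {x. c < \<bar>h x\<bar> * t} x) \<partial>lebesgue) r"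
          unfolding m_def
          by (intro mult_left_mono sum_lux_norm_gt_le[OF \<Phi> c0 c1 t r(1) _ E _ _ h]) (use S in auto)
        also have "\<dots> = epow (\<integral>\<^sup>+x. F x t \<partial>lebesgue) r"
        proof -
          have kt: "ennreal (k t) = epow (ennreal (k t powr (1 / r))) r"
            using k[of t] r by (simp add: epow_ennreal powr_powr)
          show ?thesis
            unfolding kt F_def epow_mult[OF r(2), symmetric] nn_integral_cmult[OF meas, symmetric]
            using t by simp
        qed
        finally show ?thesis .
      qed simp
    qed
    finally have 1: "(\<integral>\<^sup>+Q. m Q * epow (lux_norm \<Phi> h Q) s \<partial>count_space S)
      \<le> (\<integral>\<^sup>+t. epow (\<integral>\<^sup>+x. F x t \<partial>lebesgue) r \<partial>lborel)" .
    have [measurable]: "(\<lambda>(x, t). F x t) \<in> borel_measurable (lebesgue \<Otimes>\<^sub>M lborel)"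
      unfolding F_def indicator_def by measurable
    have "epow (\<integral>\<^sup>+t. epow (\<integral>\<^sup>+x. F x t \<partial>lebesgue) r \<partial>lborel) (1 / r)
      \<le> (\<integral>\<^sup>+x. epow (\<integral>\<^sup>+t. epow (F x t) r \<partial>lborel) (1 / r) \<partial>lebesgue)"
      by (rule nn_integral_Minkowski[OF sigma_finite_lebesgue sigma_finite_lborel _ r(1)]) measurable
    also have "\<dots> = (\<integral>\<^sup>+x. ennreal (2 * J powr (1 / r)) * ennreal (\<bar>h x\<bar> powr p) \<partial>lebesgue)"
    proof (rule nn_integral_cong)
      fix x
      have \<Phi>0: "0 \<le> \<Phi> \<bar>\<bar>h x\<bar> * t\<bar>" for t by (simp add: orlicz_fun_nonneg[OF \<Phi>])
      \<comment> \<open>For fixed \<open>x\<close> the integral over \<open>t\<close> is, up to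
        \<open>2 powr r\<close>, the tail integral scaled by \<open>y = |h x|\<close>.\<close>
      have "(\<integral>\<^sup>+t. epow (F x t) r \<partial>lborel)
        = (\<integral>\<^sup>+t. ennreal (2 powr r) * (ennreal (s * t powr (- s - 1) * \<Phi> \<bar>\<bar>h x\<bar> * t\<bar> powr r)
            * indicator {t. 0 < t \<and> c < \<bar>h x\<bar> * t} t) \<partial>lborel)"
      proof (rule nn_integral_cong)
        fix t :: real
        define z where "z = \<Phi> \<bar>\<bar>h x\<bar> * t\<bar>"
        have z: "0 \<le> z" unfolding z_def by (rule \<Phi>0)
        have F_eq: "F x t = (if 0 < t \<and> c < \<bar>h x\<bar> * t then ennreal (k t powr (1 / r) * (2 * z)) else 0)"
          using k[of t] z unfolding F_def z_def[symmetric] by (auto simp: ennreal_mult)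
        have "(k t powr (1 / r) * (2 * z)) powr r = 2 powr r * (k t * z powr r)"
          using k[of t] z r by (simp add: powr_mult powr_powr)
        then have "epow (F x t) r = (if 0 < t \<and> c < \<bar>h x\<bar> * t
            then ennreal (2 powr r * (k t * z powr r)) else 0)"
          unfolding F_eq using k[of t] z by (simp add: epow_ennreal)
        then show "epow (F x t) r = ennreal (2 powr r) * (ennreal (s * t powr (- s - 1) * \<Phi> \<bar>\<bar>h x\<bar> * t\<bar> powr r)
            * indicator {t. 0 < t \<and> c < \<bar>h x\<bar> * t} t)"
          unfolding k_def z_def[symmetric] by (auto simp: ennreal_mult')
      qed
      also have "\<dots> = ennreal (2 powr r) * (\<integral>\<^sup>+t. ennreal (s * t powr (- s - 1) * \<Phi> \<bar>\<bar>h x\<bar> * t\<bar> powr r)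
            * indicator {t. 0 < t \<and> c < \<bar>h x\<bar> * t} t \<partial>lborel)"
        by (rule nn_integral_cmult) measurable
      also have "\<dots> = ennreal (2 powr r) * (ennreal (\<bar>h x\<bar> powr s) * ennreal J)"
        by (subst orlicz_tail_scale[OF \<Phi> c0 s]) (simp_all add: J)
      also have "\<dots> = ennreal (2 powr r * (\<bar>h x\<bar> powr s * J))"
        using J by (simp add: ennreal_mult)
      finally have eq: "(\<integral>\<^sup>+t. epow (F x t) r \<partial>lborel) = \<dots>" .
      \<comment> \<open>Since \<open>s / r = p\<close>, the \<open>r\<close>-th root turns
        \<open>|h|^s\<close> into \<open>|h|^p\<close>.\<close>
      have "(2 powr r * (\<bar>h x\<bar> powr s * J)) powr (1 / r) = 2 * J powr (1 / r) * \<bar>h x\<bar> powr p"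
        using J r rp by (simp add: powr_mult powr_powr)
      then show "epow (\<integral>\<^sup>+t. epow (F x t) r \<partial>lborel) (1 / r)
        = ennreal (2 * J powr (1 / r)) * ennreal (\<bar>h x\<bar> powr p)"
        unfolding eq using J by (subst epow_ennreal) (simp_all add: ennreal_mult)
    qed
    also have "\<dots> = ennreal (2 * J powr (1 / r)) * (\<integral>\<^sup>+x. ennreal (\<bar>h x\<bar> powr p) \<partial>lebesgue)"
      by (rule nn_integral_cmult) measurable
    finally have "(\<integral>\<^sup>+t. epow (\<integral>\<^sup>+x. F x t \<partial>lebesgue) r \<partial>lborel)
      \<le> epow (ennreal (2 * J powr (1 / r)) * (\<integral>\<^sup>+x. ennreal (\<bar>h x\<bar> powr p) \<partial>lebesgue)) r"
      using epow_le_iff[of "1 / r"] r by simp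
    also have "\<dots> = ennreal (2 powr r * J) * epow (\<integral>\<^sup>+x. ennreal (\<bar>h x\<bar> powr p) \<partial>lebesgue) r"
      using r J by (simp add: epow_mult epow_ennreal powr_mult powr_powr)
    finally show ?thesis using 1 by (simp add: m_def r_def)
  qed
  then show ?thesis using J by (intro exI[of _ "2 powr r * J"]) auto
qed

section \<open>The sparse operator\<close>

text \<open>Enumerating an infinite \<open>I\<close> turns the integral into a series of measurable
  functions; a finite \<open>I\<close> gives a finite sum.\<close>

lemma borel_measurable_nn_integral_count_space:
  fixes f :: "'i \<Rightarrow> 'a \<Rightarrow> ennreal"
  assumes I: "countable I" and [measurable]: "\<And>i. i \<in> I \<Longrightarrow> f i \<in> borel_measurable M"
  shows "(\<lambda>x. \<integral>\<^sup>+i. f i x \<partial>count_space I) \<in> borel_measurable M"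
proof (cases "finite I")
  case True
  then show ?thesis by (simp add: nn_integral_count_space_finite)
next
  case False
  then have ne: "I \<noteq> {}" by auto
  have [measurable]: "f (from_nat_into I n) \<in> borel_measurable M" for n
    using from_nat_into[OF ne] by simp
  have "(\<integral>\<^sup>+i. f i x \<partial>count_space I) = (\<Sum>n. f (from_nat_into I n) x)" for x
    by (simp add: nn_integral_bij_count_space[symmetric, OF bij_betw_from_nat_into[OF I False]]
        nn_integral_count_space_nat)
  then show ?thesis by simp
qed

lemma conj_exp:
  assumes "1 < r"
  shows "1 < conj_exp r" "1 / r + 1 / conj_exp r = 1"
  using assms by (auto simp: conj_exp_def field_simps)

text \<open>This takes the \<open>s\<close>-th root of the Carleson bound and puts the weights into
  the form in which Hoelder's inequality over the cubes produces them:
  \<open>|E Q| |Q|^(s/p-1)\<close> is the \<open>s\<close>-th power of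
  \<open>|E Q|^(1/s) |Q|^(1/p-1/s)\<close>.\<close>

lemma sum_lux_norm_power_le:
  assumes "(\<integral>\<^sup>+Q. emeasure lebesgue (E Q) * ennreal (measure lebesgue Q powr (s / p - 1))
      * epow (lux_norm \<Phi> h Q) s \<partial>count_space S)
    \<le> ennreal C * epow (\<integral>\<^sup>+x. ennreal (\<bar>h x\<bar> powr p) \<partial>lebesgue) (s / p)"
    and S: "\<And>Q. Q \<in> S \<Longrightarrow> Q \<in> lmeasurable \<and> 0 < measure lebesgue Q \<and> E Q \<subseteq> Q \<and> E Q \<in> sets lebesgue"
    and s: "0 < s" "0 < p" and C: "0 \<le> C"
  shows "epow (\<integral>\<^sup>+Q. epow (ennreal (measure lebesgue (E Q) powr (1 / s) * measure lebesgue Q powr (1 / p - 1 / s))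
        * lux_norm \<Phi> h Q) s \<partial>count_space S) (1 / s)
    \<le> ennreal (C powr (1 / s)) * epow (\<integral>\<^sup>+x. ennreal (\<bar>h x\<bar> powr p) \<partial>lebesgue) (1 / p)"
proof -
  have "(\<integral>\<^sup>+Q. epow (ennreal (measure lebesgue (E Q) powr (1 / s) * measure lebesgue Q powr (1 / p - 1 / s))
        * lux_norm \<Phi> h Q) s \<partial>count_space S)
    = (\<integral>\<^sup>+Q. emeasure lebesgue (E Q) * ennreal (measure lebesgue Q powr (s / p - 1))
      * epow (lux_norm \<Phi> h Q) s \<partial>count_space S)"
  proof (rule nn_integral_cong)
    fix Q assume "Q \<in> space (count_space S)"
    then have Q: "Q \<in> lmeasurable" "0 < measure lebesgue Q" "E Q \<subseteq> Q" "E Q \<in> sets lebesgue"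
      using S by auto
    have "E Q \<in> lmeasurable" using fmeasurableI2[OF Q(1,3,4)] .
    then have E: "emeasure lebesgue (E Q) = ennreal (measure lebesgue (E Q))"
      by (rule emeasure_eq_measure2)
    have "(1 / p - 1 / s) * s = s / p - 1" using s by (simp add: field_simps)
    then have "(measure lebesgue (E Q) powr (1 / s) * measure lebesgue Q powr (1 / p - 1 / s)) powr s
        = measure lebesgue (E Q) * measure lebesgue Q powr (s / p - 1)"
      using s by (simp add: powr_mult powr_powr)
    then have "epow (ennreal (measure lebesgue (E Q) powr (1 / s) * measure lebesgue Q powr (1 / p - 1 / s))) s
        = ennreal (measure lebesgue (E Q)) * ennreal (measure lebesgue Q powr (s / p - 1))"
      by (subst epow_ennreal) (simp_all add: ennreal_mult)
    then show "epow (ennreal (measure lebesgue (E Q) powr (1 / s) * measure lebesgue Q powr (1 / p - 1 / s))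
        * lux_norm \<Phi> h Q) s = emeasure lebesgue (E Q) * ennreal (measure lebesgue Q powr (s / p - 1))
      * epow (lux_norm \<Phi> h Q) s"
      unfolding epow_mult[OF s(1)] E by simp
  qed
  also have "epow \<dots> (1 / s) \<le> epow (ennreal C * epow (\<integral>\<^sup>+x. ennreal (\<bar>h x\<bar> powr p) \<partial>lebesgue) (s / p)) (1 / s)"
    using assms(1) s by (intro epow_mono) auto
  also have "\<dots> = ennreal (C powr (1 / s)) * epow (\<integral>\<^sup>+x. ennreal (\<bar>h x\<bar> powr p) \<partial>lebesgue) (1 / p)"
    using s C by (simp add: epow_mult epow_epow epow_ennreal)
  finally show ?thesis .
qed

theorem theorem3p5:
  fixes p q \<alpha> s \<eta> :: real and m :: nat and \<tau> :: "nat set"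
    and A B :: "real \<Rightarrow> real"
  assumes "1 < p" "p \<le> q"
    and "0 \<le> \<alpha>" "\<alpha> < real DIM('a::euclidean_space)"
    and "1 \<le> m" "\<tau> \<subseteq> {1..m}"
    and "young_fun A" "young_fun B"
    and "p \<le> s" "s \<le> q"
    and "B_cond (conj_exp q) (conj_exp s) (assoc_young A)"
    and "B_cond p s (assoc_young B)"
    and "0 < \<eta>" "\<eta> < 1"
  shows "\<exists>C>0. \<forall>(b :: nat \<Rightarrow> 'a \<Rightarrow> real) (S :: 'a set set) u v f.
     (\<forall>i\<in>{1..m}. loc_integrable (b i)) \<longrightarrow>
     (\<forall>Q\<in>S. dyadic_cube Q) \<longrightarrow> sparse_family \<eta> S \<longrightarrow>
     weight_pair u v \<longrightarrow>
     f \<in> borel_measurable lebesgue \<longrightarrow>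
     wLp_norm_enn q u (sparse_op \<alpha> m \<tau> S b f)
       \<le> ennreal C * K_const \<alpha> p q m \<tau> A B S b u v * wLp_norm p v f"
proof -

  \<comment> \<open>Exponents and constants\<close>
  note A = \<open>young_fun A\<close> and B = \<open>young_fun B\<close> and \<eta> = \<open>0 < \<eta>\<close>
  have p: "1 < p" and s: "1 < s" and q: "1 < q" and ps: "p \<le> s" and sq: "s \<le> q"
    using assms by auto
  note s' = conj_exp[OF s] and q' = conj_exp[OF q]
  \<comment> \<open>Conjugation reverses \<open>s \<le> q\<close>; the embedding for the dual pair
    asks for its exponents in this order.\<close>
  have q's': "conj_exp q \<le> conj_exp s"
    using s q sq by (simp add: conj_exp_def field_simps)
  have p0: "0 < p" and q'0: "0 < conj_exp q" using p q' by auto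
  \<comment> \<open>This embedding will be applied to \<open>f v^(1/p)\<close>, the next one to the
    dual function \<open>g\<close>.\<close>
  from orlicz_carleson_embedding[OF orlicz_fun_assoc_young[OF B] p0 ps \<open>B_cond p s (assoc_young B)\<close>,
      where 'a = 'a]
  obtain C1 where C1: "0 \<le> C1" and C1_le: "\<forall>(S :: 'a set set) E h.
    (\<forall>Q\<in>S. dyadic_cube Q \<and> E Q \<subseteq> Q \<and> E Q \<in> sets lebesgue) \<longrightarrow> disjoint_family_on E S \<longrightarrow>
    h \<in> borel_measurable lebesgue \<longrightarrow>
    (\<integral>\<^sup>+Q. emeasure lebesgue (E Q) * ennreal (measure lebesgue Q powr (s / p - 1))
      * epow (lux_norm (assoc_young B) h Q) s \<partial>count_space S)
    \<le> ennreal C1 * epow (\<integral>\<^sup>+x. ennreal (\<bar>h x\<bar> powr p) \<partial>lebesgue) (s / p)"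
    by (elim exE conjE)
  from orlicz_carleson_embedding[OF orlicz_fun_assoc_young[OF A] q'0 q's'
      \<open>B_cond (conj_exp q) (conj_exp s) (assoc_young A)\<close>, where 'a = 'a]
  obtain C2 where C2: "0 \<le> C2" and C2_le: "\<forall>(S :: 'a set set) E h.
    (\<forall>Q\<in>S. dyadic_cube Q \<and> E Q \<subseteq> Q \<and> E Q \<in> sets lebesgue) \<longrightarrow> disjoint_family_on E S \<longrightarrow>
    h \<in> borel_measurable lebesgue \<longrightarrow>
    (\<integral>\<^sup>+Q. emeasure lebesgue (E Q) * ennreal (measure lebesgue Q powr (conj_exp s / conj_exp q - 1))
      * epow (lux_norm (assoc_young A) h Q) (conj_exp s) \<partial>count_space S)
    \<le> ennreal C2 * epow (\<integral>\<^sup>+x. ennreal (\<bar>h x\<bar> powr conj_exp q) \<partial>lebesgue) (conj_exp s / conj_exp q)"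
    by (elim exE conjE)
  \<comment> \<open>The two Hoelder inequalities on a cube contribute \<open>2 * 2\<close>,
    sparseness contributes \<open>1 / \<eta>\<close>, and the embeddings contribute the roots of
    \<open>C1\<close> and \<open>C2\<close>.\<close>
  define C where "C = 4 / \<eta> * (C1 powr (1 / s) * C2 powr (1 / conj_exp s))"
  have ennreal_split: "ennreal (4 / \<eta> * (x * y)) = ennreal (4 / \<eta>) * (ennreal x * ennreal y)"
    if "0 \<le> x" "0 \<le> y" for x y
  proof -
    have "0 \<le> 4 / \<eta>" using \<eta> by simp
    then show ?thesis by (simp only: ennreal_mult mult_nonneg_nonneg that)
  qed
  have C0: "0 \<le> C" using \<eta> by (simp add: C_def)
  have bound: "wLp_norm_enn q u (sparse_op \<alpha> m \<tau> S b f)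
       \<le> ennreal C * K_const \<alpha> p q m \<tau> A B S b u v * wLp_norm p v f"
    if b: "\<forall>i\<in>{1..m}. loc_integrable (b i)" and S: "\<forall>Q\<in>S. dyadic_cube Q"
      and sparse: "sparse_family \<eta> S" and uv: "weight_pair u v"
      and f [measurable]: "f \<in> borel_measurable lebesgue"
    for b :: "nat \<Rightarrow> 'a \<Rightarrow> real" and S :: "'a set set" and u v f
  proof -

    \<comment> \<open>Estimates on a single cube\<close>
    define K where "K = K_const \<alpha> p q m \<tau> A B S b u v"
    define \<tau>' where "\<tau>' = {1..m} - \<tau>"
    have fin: "finite \<tau>" "finite \<tau>'" using assms finite_subset by (auto simp: \<tau>'_def)
    have [measurable]: "b i \<in> borel_measurable lebesgue" if "i \<in> \<tau> \<or> i \<in> \<tau>'" for i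
      using b that assms by (intro loc_integrable_imp_measurable) (auto simp: \<tau>'_def)
    have [measurable]: "u \<in> borel_measurable lebesgue" "v \<in> borel_measurable lebesgue"
      and nonneg: "\<And>x. 0 \<le> u x" "\<And>x. 0 \<le> v x" and v: "AE x in lebesgue. 0 < v x"
      using uv by (auto simp: weight_pair_def weight_def loc_integrable_imp_measurable)
    note lm = dyadic_cube_lmeasurable[OF bspec[OF S]]
    have countS: "countable S"
      by (rule countable_subset[OF _ countable_dyadic_cubes]) (use S in auto)
    obtain E where E: "disjoint_family_on E S"
      "\<And>Q. Q \<in> S \<Longrightarrow> E Q \<subseteq> Q \<and> E Q \<in> sets lebesgue \<and> \<eta> * measure lebesgue Q \<le> measure lebesgue (E Q)"
      using sparse unfolding sparse_family_def by blast
    \<comment> \<open>The weight is built into \<open>h\<close>, whose \<open>L^p\<close> norm is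
      that of \<open>f\<close> in \<open>L^p(v)\<close>. Below, \<open>\<phi> Q\<close> and
      \<open>\<psi> Q\<close> are the functions whose norms enter \<open>K\<close>.\<close>
    define h where "h x = f x * v x powr (1 / p)" for x
    have [measurable]: "h \<in> borel_measurable lebesgue" unfolding h_def by measurable
    define \<phi> where "\<phi> Q x = (\<Prod>i\<in>\<tau>. b i x - avg (b i) Q) * u x powr (1 / q)" for Q x
    define \<psi> where "\<psi> Q x = (\<Prod>l\<in>\<tau>'. b l x - avg (b l) Q) * v x powr (- 1 / p)" for Q x
    have [measurable]: "\<phi> Q \<in> borel_measurable lebesgue" "\<psi> Q \<in> borel_measurable lebesgue" for Q
      unfolding \<phi>_def \<psi>_def by measurable
    define I where "I Q = (\<integral>\<^sup>+y. indicator Q y * ennreal ((\<Prod>l\<in>\<tau>'. \<bar>b l y - avg (b l) Q\<bar>) * \<bar>f y\<bar>) \<partial>lebesgue)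
      / ennreal (measure lebesgue Q)" for Q
    \<comment> \<open>Including \<open>u^(1/q)\<close> turns the weighted norm into an unweighted
      \<open>L^q\<close> norm, to which duality applies.\<close>
    define G where "G x = sparse_op \<alpha> m \<tau> S b f x * ennreal (u x powr (1 / q))" for x
    have G_eq: "G x = (\<integral>\<^sup>+Q. ennreal (measure lebesgue Q powr (\<alpha> / real DIM('a))) * I Q
        * (indicator Q x * ennreal \<bar>\<phi> Q x\<bar>) \<partial>count_space S)" for x
    proof -
      have "G x = (\<integral>\<^sup>+Q. ennreal (measure lebesgue Q powr (\<alpha> / real DIM('a)))
          * ennreal (\<Prod>i\<in>\<tau>. \<bar>b i x - avg (b i) Q\<bar>) * I Q * indicator Q x
          * ennreal (u x powr (1 / q)) \<partial>count_space S)"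
        unfolding G_def sparse_op_def I_def \<tau>'_def by (rule nn_integral_multc[symmetric]) simp
      also have "\<dots> = (\<integral>\<^sup>+Q. ennreal (measure lebesgue Q powr (\<alpha> / real DIM('a))) * I Q
        * (indicator Q x * ennreal \<bar>\<phi> Q x\<bar>) \<partial>count_space S)"
        unfolding \<phi>_def by (intro nn_integral_cong) (simp add: abs_mult abs_prod ennreal_mult prod_nonneg mult_ac)
      finally show ?thesis .
    qed
    have meas_term: "(\<lambda>x. ennreal (measure lebesgue Q powr (\<alpha> / real DIM('a))) * I Q
        * (indicator Q x * ennreal \<bar>\<phi> Q x\<bar>)) \<in> borel_measurable lebesgue" if "Q \<in> S" for Q
    proof -
      have [measurable]: "Q \<in> sets lebesgue" using lm(1)[OF that] by (rule fmeasurableD)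
      show ?thesis by measurable
    qed
    have [measurable]: "G \<in> borel_measurable lebesgue"
      unfolding G_eq by (intro borel_measurable_nn_integral_count_space countS meas_term)
    \<comment> \<open>As \<open>v > 0\<close> almost everywhere, the powers of \<open>v\<close> in
      \<open>\<psi> Q\<close> and \<open>h\<close> cancel, and the average in the operator becomes a
      pairing of these two functions.\<close>
    have I_le: "I Q \<le> 2 * (lux_norm B (\<psi> Q) Q * lux_norm (assoc_young B) h Q)" if Q: "Q \<in> S" for Q
    proof -
      have "(\<integral>\<^sup>+y. indicator Q y * ennreal ((\<Prod>l\<in>\<tau>'. \<bar>b l y - avg (b l) Q\<bar>) * \<bar>f y\<bar>) \<partial>lebesgue)
        = (\<integral>\<^sup>+y. indicator Q y * ennreal \<bar>\<psi> Q y * h y\<bar> \<partial>lebesgue)"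
      proof (rule nn_integral_cong_AE, use v in eventually_elim)
        fix y assume "0 < v y"
        then have "v y powr (- 1 / p) * v y powr (1 / p) = 1" by (simp add: powr_add[symmetric])
        then have "\<psi> Q y * h y = (\<Prod>l\<in>\<tau>'. b l y - avg (b l) Q) * f y"
          by (simp add: \<psi>_def h_def)
        then show "indicator Q y * ennreal ((\<Prod>l\<in>\<tau>'. \<bar>b l y - avg (b l) Q\<bar>) * \<bar>f y\<bar>)
          = indicator Q y * ennreal \<bar>\<psi> Q y * h y\<bar>"
          by (simp add: abs_mult abs_prod)
      qed
      also have "\<dots> \<le> 2 * ennreal (measure lebesgue Q) * (lux_norm B (\<psi> Q) Q * lux_norm (assoc_young B) h Q)"
        by (rule lux_norm_Hoelder[OF orlicz_fun_young[OF B] orlicz_fun_assoc_young[OF B]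
              assoc_young_inequality[OF B] lm[OF Q]]) auto
      finally show ?thesis
        unfolding I_def using lm(2)[OF Q] by (intro divide_le_posI_ennreal) (auto simp: mult_ac)
    qed

    \<comment> \<open>Pairing with a test function and summation over the cubes\<close>
    have main: "(\<integral>\<^sup>+x. G x * ennreal (g x) \<partial>lebesgue)
      \<le> ennreal C * K * wLp_norm p v f * epow (\<integral>\<^sup>+x. epow (ennreal (g x)) (conj_exp q) \<partial>lebesgue) (1 / conj_exp q)"
      if g [measurable]: "g \<in> borel_measurable lebesgue" and g0: "\<And>x. 0 \<le> g x" for g :: "'a \<Rightarrow> real"
    proof -
      \<comment> \<open>The factor \<open>|E Q| |Q|^(1/p-1/q)\<close> is shared between
        \<open>X\<close> and \<open>Y\<close> by means of \<open>1/s + 1/s' = 1\<close> and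
        \<open>1/q' - 1/s' = 1/s - 1/q\<close>.\<close>
      define X where "X Q = ennreal (measure lebesgue (E Q) powr (1 / s) * measure lebesgue Q powr (1 / p - 1 / s))
        * lux_norm (assoc_young B) h Q" for Q
      define Y where "Y Q = ennreal (measure lebesgue (E Q) powr (1 / conj_exp s)
          * measure lebesgue Q powr (1 / conj_exp q - 1 / conj_exp s)) * lux_norm (assoc_young A) g Q" for Q
      have "(\<integral>\<^sup>+x. G x * ennreal (g x) \<partial>lebesgue)
        = (\<integral>\<^sup>+x. (\<integral>\<^sup>+Q. ennreal (measure lebesgue Q powr (\<alpha> / real DIM('a))) * I Q
          * (indicator Q x * ennreal \<bar>\<phi> Q x\<bar>) * ennreal (g x) \<partial>count_space S) \<partial>lebesgue)"
        unfolding G_eq by (intro nn_integral_cong nn_integral_multc[symmetric]) simp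
      also have "\<dots> = (\<integral>\<^sup>+Q. (\<integral>\<^sup>+x. ennreal (measure lebesgue Q powr (\<alpha> / real DIM('a))) * I Q
          * (indicator Q x * ennreal \<bar>\<phi> Q x\<bar>) * ennreal (g x) \<partial>lebesgue) \<partial>count_space S)"
        by (rule nn_integral_count_space_nn_integral[OF countS])
          (rule borel_measurable_times_ennreal[OF meas_term], assumption, measurable)
      also have "\<dots> \<le> (\<integral>\<^sup>+Q. ennreal (4 / \<eta>) * K * (X Q * Y Q) \<partial>count_space S)"
      proof (rule nn_integral_mono)
        fix Q assume "Q \<in> space (count_space S)"
        then have Q: "Q \<in> S" by simp
        note lmQ = lm[OF Q]
        have [measurable]: "Q \<in> sets lebesgue" using lmQ(1) by (rule fmeasurableD)
        define w where "w = measure lebesgue Q"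
        define e where "e = measure lebesgue (E Q)"
        have w: "0 < w" using lmQ by (simp add: w_def)
        have we: "\<eta> * w \<le> e" using E(2)[OF Q] by (simp add: w_def e_def)
        then have e: "0 < e" using \<eta> w by (meson less_le_trans mult_pos_pos)
        define NA where "NA = lux_norm A (\<phi> Q) Q"
        define NB where "NB = lux_norm B (\<psi> Q) Q"
        define Nh where "Nh = lux_norm (assoc_young B) h Q"
        define Ng where "Ng = lux_norm (assoc_young A) g Q"
        have K: "ennreal (w powr (\<alpha> / real DIM('a) + 1 / q - 1 / p)) * NA * NB \<le> K"
          unfolding K_def K_const_def w_def NA_def NB_def \<phi>_def \<psi>_def \<tau>'_def
          using Q by (rule SUP_upper)
        have "(\<integral>\<^sup>+x. ennreal (measure lebesgue Q powr (\<alpha> / real DIM('a))) * I Q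
            * (indicator Q x * ennreal \<bar>\<phi> Q x\<bar>) * ennreal (g x) \<partial>lebesgue)
          = (\<integral>\<^sup>+x. ennreal (w powr (\<alpha> / real DIM('a))) * I Q * (indicator Q x * ennreal \<bar>\<phi> Q x * g x\<bar>) \<partial>lebesgue)"
          using g0 by (intro nn_integral_cong) (simp add: w_def abs_mult ennreal_mult mult_ac)
        also have "\<dots> = ennreal (w powr (\<alpha> / real DIM('a))) * I Q * (\<integral>\<^sup>+x. indicator Q x * ennreal \<bar>\<phi> Q x * g x\<bar> \<partial>lebesgue)"
          by (rule nn_integral_cmult) measurable
        also have "\<dots> \<le> ennreal (w powr (\<alpha> / real DIM('a))) * (2 * (NB * Nh)) * (2 * ennreal w * (NA * Ng))"
        proof (intro mult_mono mult_left_mono)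
          show "I Q \<le> 2 * (NB * Nh)" using I_le[OF Q] by (simp add: NB_def Nh_def)
          show "(\<integral>\<^sup>+x. indicator Q x * ennreal \<bar>\<phi> Q x * g x\<bar> \<partial>lebesgue) \<le> 2 * ennreal w * (NA * Ng)"
            unfolding w_def NA_def Ng_def
            by (rule lux_norm_Hoelder[OF orlicz_fun_young[OF A] orlicz_fun_assoc_young[OF A]
                  assoc_young_inequality[OF A] lmQ]) auto
        qed auto
        also have "\<dots> = 4 * (ennreal (w powr (\<alpha> / real DIM('a))) * ennreal w) * (NA * NB) * (Nh * Ng)"
          by (simp add: mult_ac)
        \<comment> \<open>The exponent appearing in \<open>K\<close> is split off, to be absorbed
          together with \<open>NA\<close> and \<open>NB\<close>; the rest,
          \<open>1 + 1/p - 1/q\<close>, is left for \<open>X\<close> and \<open>Y\<close>.\<close>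
        also have "ennreal (w powr (\<alpha> / real DIM('a))) * ennreal w
          = ennreal (w powr (\<alpha> / real DIM('a) + 1 / q - 1 / p)) * ennreal (w powr (1 + 1 / p - 1 / q))"
        proof -
          have "w powr (\<alpha> / real DIM('a)) * w = w powr (\<alpha> / real DIM('a)) * w powr 1" using w by simp
          also have "\<dots> = w powr (\<alpha> / real DIM('a) + 1 / q - 1 / p) * w powr (1 + 1 / p - 1 / q)"
            unfolding powr_add[symmetric] by simp
          finally show ?thesis using w by (simp add: ennreal_mult[symmetric])
        qed
        also have "4 * (ennreal (w powr (\<alpha> / real DIM('a) + 1 / q - 1 / p)) * ennreal (w powr (1 + 1 / p - 1 / q))) * (NA * NB) * (Nh * Ng)
          = (ennreal (w powr (\<alpha> / real DIM('a) + 1 / q - 1 / p)) * NA * NB) * (ennreal (4 * w powr (1 + 1 / p - 1 / q)) * (Nh * Ng))"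
          by (simp add: ennreal_mult mult_ac)
        also have "\<dots> \<le> K * (ennreal (4 / \<eta> * ((e powr (1 / s) * w powr (1 / p - 1 / s))
            * (e powr (1 / conj_exp s) * w powr (1 / conj_exp q - 1 / conj_exp s)))) * (Nh * Ng))"
        proof (rule mult_mono[OF K mult_right_mono[OF ennreal_leI]])
          have exps: "1 / conj_exp q - 1 / conj_exp s = 1 / s - 1 / q" using s' q' by linarith
          have "e powr (1 / s) * e powr (1 / conj_exp s) = e"
            unfolding powr_add[symmetric] s'(2) using e by simp
          moreover have "w powr (1 / p - 1 / s) * w powr (1 / conj_exp q - 1 / conj_exp s) = w powr (1 / p - 1 / q)"
            unfolding powr_add[symmetric] exps by simp
          ultimately have eq: "(e powr (1 / s) * w powr (1 / p - 1 / s))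
            * (e powr (1 / conj_exp s) * w powr (1 / conj_exp q - 1 / conj_exp s)) = e * w powr (1 / p - 1 / q)"
            by (metis mult.assoc mult.left_commute)
          \<comment> \<open>Sparseness trades one factor \<open>|Q|\<close> for
            \<open>|E Q| / \<eta>\<close>, which brings in the disjoint sets of the Carleson
            sums.\<close>
          have "w powr (1 + 1 / p - 1 / q) = w * w powr (1 / p - 1 / q)"
            using w powr_add[of w 1 "1 / p - 1 / q"] by (simp add: add_diff_eq)
          also have "\<dots> \<le> e / \<eta> * w powr (1 / p - 1 / q)"
            using we \<eta> by (intro mult_right_mono) (auto simp: field_simps)
          finally show "4 * w powr (1 + 1 / p - 1 / q) \<le> 4 / \<eta> * ((e powr (1 / s) * w powr (1 / p - 1 / s))
            * (e powr (1 / conj_exp s) * w powr (1 / conj_exp q - 1 / conj_exp s)))"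
            unfolding eq by simp
        qed auto
        also have "\<dots> = ennreal (4 / \<eta>) * K * (X Q * Y Q)"
          unfolding X_def Y_def Nh_def Ng_def w_def e_def
          by (subst ennreal_split) (simp_all add: mult_ac)
        finally show "(\<integral>\<^sup>+x. ennreal (measure lebesgue Q powr (\<alpha> / real DIM('a))) * I Q
          * (indicator Q x * ennreal \<bar>\<phi> Q x\<bar>) * ennreal (g x) \<partial>lebesgue) \<le> ennreal (4 / \<eta>) * K * (X Q * Y Q)" .
      qed
      also have "\<dots> = ennreal (4 / \<eta>) * K * (\<integral>\<^sup>+Q. X Q * Y Q \<partial>count_space S)"
        by (rule nn_integral_cmult) simp
      also have "\<dots> \<le> ennreal (4 / \<eta>) * K * (epow (\<integral>\<^sup>+Q. epow (X Q) s \<partial>count_space S) (1 / s)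
          * epow (\<integral>\<^sup>+Q. epow (Y Q) (conj_exp s) \<partial>count_space S) (1 / conj_exp s))"
        by (intro mult_left_mono nn_integral_Hoelder s s') auto
      also have "\<dots> \<le> ennreal (4 / \<eta>) * K * ((ennreal (C1 powr (1 / s)) * epow (\<integral>\<^sup>+x. ennreal (\<bar>h x\<bar> powr p) \<partial>lebesgue) (1 / p))
          * (ennreal (C2 powr (1 / conj_exp s)) * epow (\<integral>\<^sup>+x. ennreal (\<bar>g x\<bar> powr conj_exp q) \<partial>lebesgue) (1 / conj_exp q)))"
      proof (intro mult_left_mono mult_mono)
        have S': "\<forall>Q\<in>S. dyadic_cube Q \<and> E Q \<subseteq> Q \<and> E Q \<in> sets lebesgue" using S E(2) by simp
        have S'': "Q \<in> lmeasurable \<and> 0 < measure lebesgue Q \<and> E Q \<subseteq> Q \<and> E Q \<in> sets lebesgue"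
          if "Q \<in> S" for Q using lm E(2) that by simp
        show "epow (\<integral>\<^sup>+Q. epow (X Q) s \<partial>count_space S) (1 / s)
          \<le> ennreal (C1 powr (1 / s)) * epow (\<integral>\<^sup>+x. ennreal (\<bar>h x\<bar> powr p) \<partial>lebesgue) (1 / p)"
          unfolding X_def
        proof (rule sum_lux_norm_power_le[OF _ S'' _ p0 C1])
          show "(\<integral>\<^sup>+Q. emeasure lebesgue (E Q) * ennreal (measure lebesgue Q powr (s / p - 1))
              * epow (lux_norm (assoc_young B) h Q) s \<partial>count_space S)
            \<le> ennreal C1 * epow (\<integral>\<^sup>+x. ennreal (\<bar>h x\<bar> powr p) \<partial>lebesgue) (s / p)"
            using C1_le S' E(1) by simp
        qed (use s in auto)
        show "epow (\<integral>\<^sup>+Q. epow (Y Q) (conj_exp s) \<partial>count_space S) (1 / conj_exp s)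
          \<le> ennreal (C2 powr (1 / conj_exp s)) * epow (\<integral>\<^sup>+x. ennreal (\<bar>g x\<bar> powr conj_exp q) \<partial>lebesgue) (1 / conj_exp q)"
          unfolding Y_def
        proof (rule sum_lux_norm_power_le[OF _ S'' _ q'0 C2])
          show "(\<integral>\<^sup>+Q. emeasure lebesgue (E Q) * ennreal (measure lebesgue Q powr (conj_exp s / conj_exp q - 1))
              * epow (lux_norm (assoc_young A) g Q) (conj_exp s) \<partial>count_space S)
            \<le> ennreal C2 * epow (\<integral>\<^sup>+x. ennreal (\<bar>g x\<bar> powr conj_exp q) \<partial>lebesgue) (conj_exp s / conj_exp q)"
            using C2_le S' E(1) g by simp
        qed (use s' in auto)
      qed auto
      also have "(\<integral>\<^sup>+x. ennreal (\<bar>h x\<bar> powr p) \<partial>lebesgue) = (\<integral>\<^sup>+x. ennreal (\<bar>f x\<bar> powr p * v x) \<partial>lebesgue)"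
        using nonneg p by (intro nn_integral_cong) (simp add: h_def abs_mult powr_mult powr_powr)
      also have "(\<integral>\<^sup>+x. ennreal (\<bar>g x\<bar> powr conj_exp q) \<partial>lebesgue) = (\<integral>\<^sup>+x. epow (ennreal (g x)) (conj_exp q) \<partial>lebesgue)"
        using g0 by (intro nn_integral_cong) (simp add: epow_ennreal)
      finally show ?thesis
        unfolding C_def wLp_norm_def by (subst ennreal_split) (simp_all add: mult_ac)
    qed
    have "wLp_norm_enn q u (sparse_op \<alpha> m \<tau> S b f) = epow (\<integral>\<^sup>+x. epow (G x) q \<partial>lebesgue) (1 / q)"
      unfolding wLp_norm_enn_def G_def using q nonneg by (simp add: epow_mult epow_ennreal powr_powr)
    also have "\<dots> \<le> ennreal C * K * wLp_norm p v f"
      by (rule nn_integral_converse_Hoelder[OF sigma_finite_lebesgue _ q q'(2) main]) measurable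
    finally show ?thesis by (simp add: K_def)
  qed
  \<comment> \<open>\<open>C\<close> is 0 if one of the embedding constants is, whereas the claim
    asks for a positive constant.\<close>
  have le: "wLp_norm_enn q u (sparse_op \<alpha> m \<tau> S b f)
       \<le> ennreal (C + 1) * K_const \<alpha> p q m \<tau> A B S b u v * wLp_norm p v f"
    if "\<forall>i\<in>{1..m}. loc_integrable (b i)" "\<forall>Q\<in>S. dyadic_cube Q" "sparse_family \<eta> S"
      "weight_pair u v" "f \<in> borel_measurable lebesgue"
    for b :: "nat \<Rightarrow> 'a \<Rightarrow> real" and S :: "'a set set" and u v f
    by (rule order_trans[OF bound[OF that]]) (intro mult_right_mono ennreal_leI, auto)
  show ?thesis
    by (rule exI[of _ "C + 1"]) (use C0 le in auto)
qed

end
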